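(* There is a hereditary $3$-graph property $\mathcal{H}$ with $\textnormal{SVC}(\mathcal{H})<\infty$ which is far from finite VC-dimension, and constants $C,C'>0$ such that $2^{\epsilon^{-C}}\leq M_{\mathcal{H}}(\epsilon)\leq 2^{\epsilon^{-C'}}$ for all sufficiently small $\epsilon>0$.
   Context: $3$-graphs $H=(V,E)$, $E\subseteq\binom V3$; hereditary $3$-graph properties are classes of finite $3$-graphs closed under isomorphism and induced sub-$3$-graphs. $d_H(X,Y,Z)=|\{(x,y,z)\in X\times Y\times Z:\{x,y,z\}\in E\}|/(|X||Y||Z|)$; a triple $(X,Y,Z)$ is $\epsilon$-regular if $|d_H(X,Y,Z)-d_H(X',Y',Z')|\le\epsilon$ whenever $X'\subseteq X,Y'\subseteq Y,Z'\subseteq Z$ have sizes at least $\epsilon|X|,\epsilon|Y|,\epsilon|Z|$; a partition $\mathcal P$ of $V$ is $\epsilon$-regular if at least $(1-\epsilon)|V|^3$ triples of $V^3$ lie in $X\times Y\times Z$ for some $\epsilon$-regular $(X,Y,Z)\in\mathcal P^3$. $M_{\mathcal H}(\epsilon)$ is the least $M$ such that all sufficiently large members of $\mathcal H$ have an $\epsilon$-regular partition with at most $M$ parts. The VC-dimension of a graph $G$ is the largest $k$ with vertices $a_i$ ($i\in[k]$), $b_S$ ($S\subseteq[k]$) such that $a_ib_S\in E(G)$ iff $i\in S$. For a $3$-graph $H$ and $x\in V$, the slice graph $H_x$ has vertex set $V$ and edges $\{yz: xyz\in E\}$; $\textnormal{SVC}(H)=\max_x \textnormal{VC}(H_x)$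 and $\textnormal{SVC}(\mathcal H)=\sup_{H\in\mathcal H}\textnormal{SVC}(H)$. The VC-dimension of a $3$-graph $H$ is the largest $k$ with vertices $a_1,b_1,\dots,a_k,b_k$ and $c_S$ ($S\subseteq[k]$) such that $a_ib_ic_S\in E$ iff $i\in S$; $\textnormal{VC}(\mathcal H)$ is the supremum over $\mathcal H$. $H=(V,E),H'=(V,E')$ are $\delta$-close if $|\overline E\Delta\overline{E'}|\le\delta|V|^3$ ($\overline E$ the set of ordered triples of edges). $\mathcal H$ is close to $\mathcal H'$ if for all $\delta>0$ there is $N$ such that each $H\in\mathcal H$ on at least $N$ vertices is $\delta$-close to some $H'\in\mathcal H'$ on the same vertex set; $\mathcal H$ is far from finite VC-dimension if it is close to no hereditary $\mathcal H'$ with $\textnormal{VC}(\mathcal H')<\infty$. *)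

theory Defs
  imports Main "HOL-Library.Extended_Nat"
begin

text \<open>A 3-graph is a pair (V, E) of a finite vertex set V and a set E of 3-element
  subsets of V. Vertices are natural numbers; since every finite 3-graph is isomorphic
  to one on natural numbers and properties are closed under isomorphism, this loses nothing.\<close>

type_synonym hg3 = "nat set \<times> nat set set"

definition is_3graph :: "hg3 \<Rightarrow> bool" where
  "is_3graph G \<longleftrightarrow> finite (fst G) \<and> snd G \<subseteq> {e. e \<subseteq> fst G \<and> card e = 3}"

definition iso_3graph :: "hg3 \<Rightarrow> hg3 \<Rightarrow> bool" where
  "iso_3graph G G' \<longleftrightarrow> (\<exists>f. bij_betw f (fst G) (fst G') \<and>
      (\<forall>e. e \<subseteq> fst G \<longrightarrow> (e \<in> snd G \<longleftrightarrow> f ` e \<in> snd G')))"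

definition induced_sub :: "hg3 \<Rightarrow> nat set \<Rightarrow> hg3" where
  "induced_sub G W = (W, {e \<in> snd G. e \<subseteq> W})"

definition hereditary :: "hg3 set \<Rightarrow> bool" where
  "hereditary \<H> \<longleftrightarrow> (\<forall>G\<in>\<H>. is_3graph G) \<and>
     (\<forall>G\<in>\<H>. \<forall>G'. is_3graph G' \<and> iso_3graph G G' \<longrightarrow> G' \<in> \<H>) \<and>
     (\<forall>G\<in>\<H>. \<forall>W. W \<subseteq> fst G \<longrightarrow> induced_sub G W \<in> \<H>)"

definition ord_edges :: "hg3 \<Rightarrow> (nat \<times> nat \<times> nat) set" where
  "ord_edges G = {(x, y, z). {x, y, z} \<in> snd G}"

definition density :: "hg3 \<Rightarrow> nat set \<Rightarrow> nat set \<Rightarrow> nat set \<Rightarrow> real" where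
  "density G X Y Z =
     real (card {(x, y, z) \<in> X \<times> Y \<times> Z. {x, y, z} \<in> snd G})
       / (real (card X) * real (card Y) * real (card Z))"

definition regular_triple :: "real \<Rightarrow> hg3 \<Rightarrow> nat set \<Rightarrow> nat set \<Rightarrow> nat set \<Rightarrow> bool" where
  "regular_triple \<epsilon> G X Y Z \<longleftrightarrow>
     (\<forall>X' Y' Z'. X' \<subseteq> X \<and> Y' \<subseteq> Y \<and> Z' \<subseteq> Z \<and>
        real (card X') \<ge> \<epsilon> * real (card X) \<and> real (card Y') \<ge> \<epsilon> * real (card Y) \<and>
        real (card Z') \<ge> \<epsilon> * real (card Z) \<longrightarrow>
        \<bar>density G X Y Z - density G X' Y' Z'\<bar> \<le> \<epsilon>)"

definition is_partition :: "nat set set \<Rightarrow> nat set \<Rightarrow> bool" where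
  "is_partition P V \<longleftrightarrow> (\<forall>X\<in>P. X \<noteq> {}) \<and> \<Union>P = V \<and>
     (\<forall>X\<in>P. \<forall>Y\<in>P. X \<noteq> Y \<longrightarrow> X \<inter> Y = {})"

definition regular_partition :: "real \<Rightarrow> hg3 \<Rightarrow> nat set set \<Rightarrow> bool" where
  "regular_partition \<epsilon> G P \<longleftrightarrow> is_partition P (fst G) \<and>
     real (card (\<Union>{X \<times> Y \<times> Z | X Y Z. X \<in> P \<and> Y \<in> P \<and> Z \<in> P \<and> regular_triple \<epsilon> G X Y Z}))
       \<ge> (1 - \<epsilon>) * real (card (fst G)) ^ 3"

definition reg_bound :: "hg3 set \<Rightarrow> real \<Rightarrow> nat" where
  "reg_bound \<H> \<epsilon> = (LEAST M. \<exists>N. \<forall>G\<in>\<H>. card (fst G) \<ge> N \<longrightarrow>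
      (\<exists>P. regular_partition \<epsilon> G P \<and> card P \<le> M))"

definition graph_shatters :: "nat set \<Rightarrow> (nat \<Rightarrow> nat \<Rightarrow> bool) \<Rightarrow> nat \<Rightarrow> bool" where
  "graph_shatters V adj k \<longleftrightarrow> (\<exists>a b. (\<forall>i\<in>{1..k}. a i \<in> V) \<and> (\<forall>S. S \<subseteq> {1..k} \<longrightarrow> b S \<in> V) \<and>
      (\<forall>i\<in>{1..k}. \<forall>S. S \<subseteq> {1..k} \<longrightarrow> (adj (a i) (b S) \<longleftrightarrow> i \<in> S)))"

definition graph_vc :: "nat set \<Rightarrow> (nat \<Rightarrow> nat \<Rightarrow> bool) \<Rightarrow> enat" where
  "graph_vc V adj = Sup {enat k | k. graph_shatters V adj k}"

definition slice_adj :: "hg3 \<Rightarrow> nat \<Rightarrow> nat \<Rightarrow> nat \<Rightarrow> bool" where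
  "slice_adj G x y z \<longleftrightarrow> {x, y, z} \<in> snd G"

definition svc :: "hg3 \<Rightarrow> enat" where
  "svc G = (SUP x\<in>fst G. graph_vc (fst G) (slice_adj G x))"

definition svc_class :: "hg3 set \<Rightarrow> enat" where
  "svc_class \<H> = (SUP G\<in>\<H>. svc G)"

definition hg_shatters :: "hg3 \<Rightarrow> nat \<Rightarrow> bool" where
  "hg_shatters G k \<longleftrightarrow> (\<exists>a b c. (\<forall>i\<in>{1..k}. a i \<in> fst G \<and> b i \<in> fst G) \<and>
      (\<forall>S. S \<subseteq> {1..k} \<longrightarrow> c S \<in> fst G) \<and>
      (\<forall>i\<in>{1..k}. \<forall>S. S \<subseteq> {1..k} \<longrightarrow> ({a i, b i, c S} \<in> snd G \<longleftrightarrow> i \<in> S)))"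

definition hg_vc :: "hg3 \<Rightarrow> enat" where
  "hg_vc G = Sup {enat k | k. hg_shatters G k}"

definition vc_class :: "hg3 set \<Rightarrow> enat" where
  "vc_class \<H> = (SUP G\<in>\<H>. hg_vc G)"

definition delta_close :: "real \<Rightarrow> hg3 \<Rightarrow> hg3 \<Rightarrow> bool" where
  "delta_close \<delta> G G' \<longleftrightarrow> fst G = fst G' \<and>
     real (card (ord_edges G - ord_edges G' \<union> (ord_edges G' - ord_edges G)))
       \<le> \<delta> * real (card (fst G)) ^ 3"

definition close_to :: "hg3 set \<Rightarrow> hg3 set \<Rightarrow> bool" where
  "close_to \<H> \<H>' \<longleftrightarrow> (\<forall>\<delta>>0. \<exists>N. \<forall>G\<in>\<H>. card (fst G) \<ge> N \<longrightarrow>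
      (\<exists>G'\<in>\<H>'. fst G' = fst G \<and> delta_close \<delta> G G'))"

definition far_from_finite_vc :: "hg3 set \<Rightarrow> bool" where
  "far_from_finite_vc \<H> \<longleftrightarrow>
     \<not> (\<exists>\<H>'. hereditary \<H>' \<and> vc_class \<H>' < \<infinity> \<and> close_to \<H> \<H>')"

end

theory Submission
  imports Defs "HOL-Library.Nat_Bijection" "HOL-Real_Asymp.Real_Asymp"
begin

text \<open>The property consists of the tripartite 3-graphs whose vertices in \<open>A\<close> and \<open>B\<close> carry
  labels \<open>f a\<close>, \<open>f b\<close> and whose vertices in \<open>C\<close> carry sets of labels \<open>h c\<close>, with \<open>abc\<close> an edge
  iff \<open>f a = f b \<in> h c\<close>. Blowing up the \<open>k\<close> labels and all \<open>2 ^ k\<close> label sets gives 3-graphs that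
  robustly shatter \<open>k\<close> pairs. In such a blowup, if \<open>\<epsilon>\<close> is small compared with \<open>k ^ -3\<close>, an
  \<open>\<epsilon>\<close>-regular partition determines the label set of at least half of \<open>C\<close>, hence has at least
  \<open>2 ^ (k - 1)\<close> parts. Conversely, only the labels carried by at least \<open>\<epsilon> ^ 5 n / 6\<close> vertices of \<open>A\<close>
  matter for \<open>\<epsilon>\<close>-regularity: partitioning by them leaves irregular only triples that contain
  edges with rare labels and have density above \<open>\<epsilon> ^ 4\<close>.\<close>

section \<open>The class of 3-graphs with matching labels: heredity and slice VC-dimension\<close>

definition diag_triple ::
  "nat set \<Rightarrow> nat set \<Rightarrow> nat set \<Rightarrow> (nat \<Rightarrow> nat) \<Rightarrow> (nat \<Rightarrow> nat set) \<Rightarrow> nat \<Rightarrow> nat \<Rightarrow> nat \<Rightarrow> bool" where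
  "diag_triple A B C f h a b c \<longleftrightarrow> a \<in> A \<and> b \<in> B \<and> c \<in> C \<and> f a = f b \<and> f a \<in> h c"

definition diag_graph ::
  "nat set \<Rightarrow> nat set \<Rightarrow> nat set \<Rightarrow> (nat \<Rightarrow> nat) \<Rightarrow> (nat \<Rightarrow> nat set) \<Rightarrow> hg3" where
  "diag_graph A B C f h = (A \<union> B \<union> C, {{a, b, c} | a b c. diag_triple A B C f h a b c})"

locale tripartite =
  fixes A B C :: "nat set"
  assumes finite_A: "finite A" and finite_B: "finite B" and finite_C: "finite C"
    and AB: "A \<inter> B = {}" and AC: "A \<inter> C = {}" and BC: "B \<inter> C = {}"

text \<open>The labellings are total functions with no bound on the number of labels. Passing to an
  induced sub-3-graph keeps \<open>f\<close> and \<open>h\<close> and only shrinks the three sides,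
  and the blowups for every \<open>k\<close> are members.\<close>

definition diag_class :: "hg3 set" where
  "diag_class = {diag_graph A B C f h | A B C f h. tripartite A B C}"

lemma diag_classI: "tripartite A B C \<Longrightarrow> diag_graph A B C f h \<in> diag_class"
  unfolding diag_class_def by blast

lemma fst_diag_graph [simp]: "fst (diag_graph A B C f h) = A \<union> B \<union> C"
  by (simp add: diag_graph_def)

lemma diag_edgeI:
  "diag_triple A B C f h a b c \<Longrightarrow> e = {a, b, c} \<Longrightarrow> e \<in> snd (diag_graph A B C f h)"
  by (auto simp: diag_graph_def)

lemma triple_eq_cases:
  assumes "{x, y, z} = {a, b, c}" and "a \<noteq> b" "a \<noteq> c" "b \<noteq> c"
  shows "x = a \<and> y = b \<and> z = c \<or> x = a \<and> y = c \<and> z = b \<or> x = b \<and> y = a \<and> z = c \<or>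
    x = b \<and> y = c \<and> z = a \<or> x = c \<and> y = a \<and> z = b \<or> x = c \<and> y = b \<and> z = a"
proof -
  have "x \<in> {a, b, c}" "y \<in> {a, b, c}" "z \<in> {a, b, c}"
    "a \<in> {x, y, z}" "b \<in> {x, y, z}" "c \<in> {x, y, z}"
    using assms(1) by blast+
  with assms(2-4) show ?thesis by auto
qed

context tripartite
begin

lemma diag_triple_distinct:
  "diag_triple A B C f h a b c \<Longrightarrow> a \<noteq> b \<and> a \<noteq> c \<and> b \<noteq> c"
  using AB AC BC by (auto simp: diag_triple_def)

lemma edge_iff:
  "{x, y, z} \<in> snd (diag_graph A B C f h) \<longleftrightarrow>
    diag_triple A B C f h x y z \<or> diag_triple A B C f h x z y \<or> diag_triple A B C f h y x z \<or>
    diag_triple A B C f h y z x \<or> diag_triple A B C f h z x y \<or> diag_triple A B C f h z y x"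
  (is "?l \<longleftrightarrow> ?r")
proof
  assume ?l
  then obtain a b c where *: "{x, y, z} = {a, b, c}" "diag_triple A B C f h a b c"
    by (auto simp: diag_graph_def)
  with triple_eq_cases[OF *(1)] diag_triple_distinct[OF *(2)] show ?r by auto
next
  assume ?r
  then show ?l
    by (elim disjE; elim diag_edgeI; blast)
qed

lemma edge_ABC:
  assumes "a \<in> A" "b \<in> B" "c \<in> C"
  shows "{a, b, c} \<in> snd (diag_graph A B C f h) \<longleftrightarrow> f a = f b \<and> f a \<in> h c"
  unfolding edge_iff diag_triple_def using assms AB AC BC by blast

lemma is_3graph_diag_graph: "is_3graph (diag_graph A B C f h)"
  unfolding is_3graph_def
proof (intro conjI subsetI)
  show "finite (fst (diag_graph A B C f h))" using finite_A finite_B finite_C by simp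
next
  fix e assume "e \<in> snd (diag_graph A B C f h)"
  then obtain a b c where e: "e = {a, b, c}" "diag_triple A B C f h a b c"
    by (auto simp: diag_graph_def)
  have "e \<subseteq> fst (diag_graph A B C f h)" using e by (auto simp: diag_triple_def)
  moreover have "card e = 3" using e(1) diag_triple_distinct[OF e(2)] by simp
  ultimately show "e \<in> {e. e \<subseteq> fst (diag_graph A B C f h) \<and> card e = 3}" by simp
qed

text \<open>Neighbourhoods in a slice are equal or disjoint, so no slice shatters two vertices.\<close>

lemma slice_rectangle:
  assumes "{x, y, z} \<in> snd (diag_graph A B C f h)" "{x, y', z} \<in> snd (diag_graph A B C f h)"
    "{x, y, z'} \<in> snd (diag_graph A B C f h)"
  shows "{x, y', z'} \<in> snd (diag_graph A B C f h)"
proof -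
  have disj: "v \<notin> A \<or> v \<notin> B" "v \<notin> A \<or> v \<notin> C" "v \<notin> B \<or> v \<notin> C" for v
    using AB AC BC by blast+
  \<comment> \<open>For \<open>x\<close> in \<open>A\<close> or \<open>B\<close> the edges of the
    slice form one complete bipartite graph; for \<open>x\<close> in \<open>C\<close> they form
    disjoint complete bipartite graphs, one for each label in \<open>h x\<close>.\<close>
  consider "x \<in> A" "x \<notin> B" "x \<notin> C" | "x \<notin> A" "x \<in> B" "x \<notin> C" | "x \<notin> A" "x \<notin> B" "x \<in> C"
    using assms(1) disj[of x] unfolding edge_iff diag_triple_def by blast
  then show ?thesis
    using assms disj[of y] disj[of z] disj[of y'] disj[of z']
    by cases (simp_all add: edge_iff diag_triple_def, (metis | argo)+)
qed

lemma svc_diag_graph: "svc (diag_graph A B C f h) \<le> 1"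
proof -
  let ?G = "diag_graph A B C f h"
  have "k \<le> 1" if sh: "graph_shatters (fst ?G) (slice_adj ?G x) k" for x k
  proof (rule ccontr)
    assume "\<not> k \<le> 1"
    then have mem: "1 \<in> {1..k}" "2 \<in> {1..k}" and sub: "{1, 2} \<subseteq> {1..k}" "{1} \<subseteq> {1..k}"
      by auto
    from sh obtain a b where
      ab: "\<forall>i\<in>{1..k}. \<forall>S. S \<subseteq> {1..k} \<longrightarrow> (slice_adj ?G x (a i) (b S) \<longleftrightarrow> i \<in> S)"
      unfolding graph_shatters_def by (elim exE conjE)
    \<comment> \<open>Three corners of the rectangle on \<open>a 1\<close>, \<open>a 2\<close> and
      \<open>b {1, 2}\<close>, \<open>b {1}\<close>. The fourth corner joins \<open>a 2\<close> to
      \<open>b {1}\<close>, although 2 is not in {1}.\<close>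
    have "slice_adj ?G x (a 1) (b {1, 2})" "slice_adj ?G x (a 2) (b {1, 2})"
      "slice_adj ?G x (a 1) (b {1})"
      using mem sub ab[rule_format, of 1 "{1, 2}"] ab[rule_format, of 2 "{1, 2}"]
        ab[rule_format, of 1 "{1}"] by simp_all
    then have "slice_adj ?G x (a 2) (b {1})"
      unfolding slice_adj_def by (rule slice_rectangle)
    then show False using ab[rule_format, OF mem(2) sub(2)] by simp
  qed
  then show ?thesis
    unfolding svc_def graph_vc_def by (auto intro!: SUP_least Sup_least simp: one_enat_def)
qed

lemma induced_sub_diag_graph:
  assumes "W \<subseteq> A \<union> B \<union> C"
  shows "induced_sub (diag_graph A B C f h) W = diag_graph (A \<inter> W) (B \<inter> W) (C \<inter> W) f h"
proof -
  have "{e \<in> snd (diag_graph A B C f h). e \<subseteq> W} = snd (diag_graph (A \<inter> W) (B \<inter> W) (C \<inter> W) f h)"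
    unfolding diag_graph_def diag_triple_def snd_conv by blast
  then show ?thesis
    using assms by (auto simp: induced_sub_def prod_eq_iff)
qed

end

lemma hereditary_diag_class: "hereditary diag_class"
  unfolding hereditary_def
proof (intro conjI ballI allI impI)
  fix G assume "G \<in> diag_class"
  then show "is_3graph G"
    by (auto simp: diag_class_def tripartite.is_3graph_diag_graph)
next
  fix G W assume "G \<in> diag_class" and W: "W \<subseteq> fst G"
  then obtain A B C f h where G: "G = diag_graph A B C f h" and tri: "tripartite A B C"
    by (auto simp: diag_class_def)
  have "tripartite (A \<inter> W) (B \<inter> W) (C \<inter> W)"
    using tri unfolding tripartite_def by auto
  then show "induced_sub G W \<in> diag_class"
    using tripartite.induced_sub_diag_graph[OF tri, of W f h] W
    unfolding G by (auto intro: diag_classI)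
next
  fix G G' assume "G \<in> diag_class" and iso: "is_3graph G' \<and> iso_3graph G G'"
  then obtain A B C f h where G: "G = diag_graph A B C f h" and tri: "tripartite A B C"
    by (auto simp: diag_class_def)
  interpret tripartite A B C by (rule tri)
  let ?V = "A \<union> B \<union> C"
  from iso obtain g where g: "bij_betw g ?V (fst G')"
    and ge: "\<And>e. e \<subseteq> ?V \<Longrightarrow> e \<in> snd G \<longleftrightarrow> g ` e \<in> snd G'"
    unfolding iso_3graph_def G by auto
  have inj: "inj_on g ?V" and img: "g ` ?V = fst G'"
    using g by (auto simp: bij_betw_def)
  \<comment> \<open>Labels are transported along the inverse of the isomorphism, so that
    \<open>g v\<close> inherits the labels of \<open>v\<close>.\<close>
  define u where "u = inv_into ?V g"
  have u: "u (g v) = v" if "v \<in> ?V" for v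
    unfolding u_def using inv_into_f_f[OF inj that] .
  have disj: "g ` X \<inter> g ` Y = {}" if "X \<inter> Y = {}" "X \<subseteq> ?V" "Y \<subseteq> ?V" for X Y
    using that inj by (metis image_empty inj_on_image_Int)
  have tri': "tripartite (g ` A) (g ` B) (g ` C)"
  proof
    show "g ` A \<inter> g ` B = {}" by (rule disj) (use AB in auto)
    show "g ` A \<inter> g ` C = {}" by (rule disj) (use AC in auto)
    show "g ` B \<inter> g ` C = {}" by (rule disj) (use BC in auto)
  qed (simp_all add: finite_A finite_B finite_C)
  have "G' = diag_graph (g ` A) (g ` B) (g ` C) (f \<circ> u) (h \<circ> u)"
  proof (rule prod_eqI)
    show "fst G' = fst (diag_graph (g ` A) (g ` B) (g ` C) (f \<circ> u) (h \<circ> u))"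
      using img by (auto simp: image_Un)
    have "snd G' = (`) g ` snd G"
    proof (intro set_eqI iffI)
      fix e assume e: "e \<in> snd G'"
      then have "e \<subseteq> g ` ?V" using iso img by (auto simp: is_3graph_def)
      then obtain e0 where "e0 \<subseteq> ?V" "e = g ` e0" by (auto simp: subset_image_iff)
      with e ge show "e \<in> (`) g ` snd G" by blast
    next
      fix e assume "e \<in> (`) g ` snd G"
      then obtain e0 where "e0 \<in> snd G" "e = g ` e0" by blast
      moreover from this is_3graph_diag_graph have "e0 \<subseteq> ?V"
        unfolding G is_3graph_def by fastforce
      ultimately show "e \<in> snd G'" using ge by blast
    qed
    also have "\<dots> = {{g a, g b, g c} | a b c. diag_triple A B C f h a b c}"
    proof (intro set_eqI iffI)
      fix e assume "e \<in> (`) g ` snd G"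
      then obtain a b c where "e = g ` {a, b, c}" "diag_triple A B C f h a b c"
        unfolding G diag_graph_def snd_conv by (elim imageE CollectE exE conjE) simp
      then show "e \<in> {{g a, g b, g c} | a b c. diag_triple A B C f h a b c}" by auto
    next
      fix e assume "e \<in> {{g a, g b, g c} | a b c. diag_triple A B C f h a b c}"
      then obtain a b c where e: "e = g ` {a, b, c}" and t: "diag_triple A B C f h a b c"
        by auto
      show "e \<in> (`) g ` snd G"
        unfolding e G using diag_edgeI[OF t refl] by (rule imageI)
    qed
    also have "\<dots> = {{a, b, c} | a b c. diag_triple (g ` A) (g ` B) (g ` C) (f \<circ> u) (h \<circ> u) a b c}"
      (is "?L = ?R")
    proof (intro subset_antisym subsetI)
      fix e assume "e \<in> ?L"
      then obtain a b c where "e = {g a, g b, g c}" "diag_triple A B C f h a b c" by blast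
      then have "diag_triple (g ` A) (g ` B) (g ` C) (f \<circ> u) (h \<circ> u) (g a) (g b) (g c)"
        using u by (auto simp: diag_triple_def)
      with \<open>e = _\<close> show "e \<in> ?R" by blast
    next
      fix e assume "e \<in> ?R"
      then obtain a b c where e: "e = {a, b, c}"
        and t: "diag_triple (g ` A) (g ` B) (g ` C) (f \<circ> u) (h \<circ> u) a b c" by blast
      then obtain a' b' c' where "a = g a'" "b = g b'" "c = g c'" "a' \<in> A" "b' \<in> B" "c' \<in> C"
        by (auto simp: diag_triple_def)
      with t have "diag_triple A B C f h a' b' c'"
        using u by (auto simp: diag_triple_def)
      with e \<open>a = _\<close> \<open>b = _\<close> \<open>c = _\<close> show "e \<in> ?L" by blast
    qed
    finally show "snd G' = snd (diag_graph (g ` A) (g ` B) (g ` C) (f \<circ> u) (h \<circ> u))"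
      by (simp add: diag_graph_def)
  qed
  then show "G' \<in> diag_class" using tri' by (simp add: diag_classI)
qed

lemma svc_diag_class: "svc_class diag_class \<le> 1"
  unfolding svc_class_def diag_class_def
  by (rule SUP_least) (auto intro: tripartite.svc_diag_graph)

section \<open>Two sufficient conditions for regular triples, and basic facts on partitions\<close>

lemma card_triples_mono:
  assumes "finite X" "finite Y" "finite Z" "X' \<subseteq> X" "Y' \<subseteq> Y" "Z' \<subseteq> Z"
  shows "card {(x, y, z) \<in> X' \<times> Y' \<times> Z'. Q x y z} \<le> card {(x, y, z) \<in> X \<times> Y \<times> Z. Q x y z}"
proof (rule card_mono)
  show "finite {(x, y, z) \<in> X \<times> Y \<times> Z. Q x y z}"
    by (rule finite_subset[of _ "X \<times> Y \<times> Z"]) (use assms in auto)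
qed (use assms in auto)

lemma density_nonneg: "0 \<le> density G X Y Z"
  unfolding density_def by simp

lemma density_const:
  assumes "finite X" "finite Y" "finite Z" "X \<noteq> {}" "Y \<noteq> {}" "Z \<noteq> {}"
    and "\<And>x y z. x \<in> X \<Longrightarrow> y \<in> Y \<Longrightarrow> z \<in> Z \<Longrightarrow> {x, y, z} \<in> snd G \<longleftrightarrow> b"
  shows "density G X Y Z = of_bool b"
proof -
  have "{(x, y, z) \<in> X \<times> Y \<times> Z. {x, y, z} \<in> snd G} = (if b then X \<times> Y \<times> Z else {})"
    using assms(7) by auto
  then show ?thesis
    using assms(1-6) by (simp add: density_def card_cartesian_product card_gt_0_iff)
qed

lemma nonempty_of_card_ge:
  assumes "finite X" "X \<noteq> {}" "0 < \<epsilon>" "\<epsilon> * real (card X) \<le> real (card X')"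
  shows "X' \<noteq> {}"
proof -
  have "0 < \<epsilon> * real (card X)" using assms by (simp add: card_gt_0_iff)
  then show ?thesis using assms(4) by auto
qed

lemma regular_triple_full:
  assumes "finite X" "finite Y" "finite Z" "X \<noteq> {}" "Y \<noteq> {}" "Z \<noteq> {}" and "0 < \<epsilon>"
    and edge: "\<And>x y z. x \<in> X \<Longrightarrow> y \<in> Y \<Longrightarrow> z \<in> Z \<Longrightarrow> {x, y, z} \<in> snd G"
  shows "regular_triple \<epsilon> G X Y Z"
  unfolding regular_triple_def
proof (intro allI impI, elim conjE)
  fix X' Y' Z'
  assume sub: "X' \<subseteq> X" "Y' \<subseteq> Y" "Z' \<subseteq> Z"
    and "\<epsilon> * real (card X) \<le> real (card X')" "\<epsilon> * real (card Y) \<le> real (card Y')"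
      "\<epsilon> * real (card Z) \<le> real (card Z')"
  then have "X' \<noteq> {}" "Y' \<noteq> {}" "Z' \<noteq> {}"
    using assms nonempty_of_card_ge by metis+
  then have "density G X' Y' Z' = of_bool True"
    using finite_subset[OF sub(1) assms(1)] finite_subset[OF sub(2) assms(2)]
      finite_subset[OF sub(3) assms(3)] edge subsetD[OF sub(1)] subsetD[OF sub(2)] subsetD[OF sub(3)]
    by (intro density_const) simp_all
  moreover have "density G X Y Z = of_bool True"
    using assms by (intro density_const) auto
  ultimately show "\<bar>density G X Y Z - density G X' Y' Z'\<bar> \<le> \<epsilon>" using \<open>0 < \<epsilon>\<close> by simp
qed

text \<open>A test box has at least the fraction \<open>\<epsilon> ^ 3\<close> of the volume, so its
  density is at most \<open>\<epsilon> ^ 4 / \<epsilon> ^ 3 = \<epsilon>\<close>. Both densities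
  then lie between 0 and \<open>\<epsilon>\<close>.\<close>

lemma regular_triple_sparse:
  assumes fin: "finite X" "finite Y" "finite Z" and "0 < \<epsilon>" "\<epsilon> \<le> 1"
    and sparse: "density G X Y Z \<le> \<epsilon> ^ 4"
  shows "regular_triple \<epsilon> G X Y Z"
  unfolding regular_triple_def
proof (intro allI impI, elim conjE)
  fix X' Y' Z'
  assume sub: "X' \<subseteq> X" "Y' \<subseteq> Y" "Z' \<subseteq> Z"
    and ge: "\<epsilon> * real (card X) \<le> real (card X')" "\<epsilon> * real (card Y) \<le> real (card Y')"
      "\<epsilon> * real (card Z) \<le> real (card Z')"
  let ?e = "\<lambda>X Y Z. real (card {(x, y, z) \<in> X \<times> Y \<times> Z. {x, y, z} \<in> snd G})"
  let ?p = "real (card X) * real (card Y) * real (card Z)"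
  let ?p' = "real (card X') * real (card Y') * real (card Z')"
  have p: "\<epsilon> ^ 3 * ?p \<le> ?p'"
  proof -
    have "(\<epsilon> * real (card X)) * (\<epsilon> * real (card Y)) * (\<epsilon> * real (card Z)) \<le> ?p'"
      using ge \<open>0 < \<epsilon>\<close> by (intro mult_mono) auto
    then show ?thesis by (simp add: power3_eq_cube mult_ac)
  qed
  have e: "?e X' Y' Z' \<le> ?e X Y Z"
    using card_triples_mono[OF fin sub] by simp
  have "density G X' Y' Z' \<le> \<epsilon>"
  \<comment> \<open>If some part is empty, the test box has no edges, and its density is 0 whatever
    the denominator.\<close>
  proof (cases "?p = 0")
    case True
    then have "?e X Y Z = 0" using fin by auto
    with e have "?e X' Y' Z' = 0" by linarith
    then show ?thesis unfolding density_def using \<open>0 < \<epsilon>\<close> by simp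
  next
    case False
    then have pos: "0 < ?p" by (simp add: zero_less_mult_iff)
    then have pos': "0 < \<epsilon> ^ 3 * ?p" using \<open>0 < \<epsilon>\<close> by simp
    have "?e X Y Z \<le> \<epsilon> ^ 4 * ?p"
      using sparse pos unfolding density_def by (simp add: pos_divide_le_eq)
    also have "\<dots> = \<epsilon> * (\<epsilon> ^ 3 * ?p)" by (simp add: eval_nat_numeral)
    also have "\<dots> \<le> \<epsilon> * ?p'" using p \<open>0 < \<epsilon>\<close> by (intro mult_left_mono) auto
    finally have "?e X' Y' Z' \<le> \<epsilon> * ?p'" using e by linarith
    moreover have "0 < ?p'" using pos' p by linarith
    ultimately show ?thesis unfolding density_def by (simp add: pos_divide_le_eq)
  qed
  moreover have "\<epsilon> ^ 4 \<le> \<epsilon>"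
    using power_decreasing[of 1 4 \<epsilon>] assms by simp
  ultimately show "\<bar>density G X Y Z - density G X' Y' Z'\<bar> \<le> \<epsilon>"
    using sparse density_nonneg[of G X Y Z] density_nonneg[of G X' Y' Z'] by linarith
qed

lemma is_partition_fibres: "is_partition ((\<lambda>y. {v \<in> V. \<phi> v = y}) ` \<phi> ` V) V"
  unfolding is_partition_def by auto

lemma partition_memD:
  assumes "is_partition P V" "X \<in> P"
  shows "X \<noteq> {}" "X \<subseteq> V"
  using assms unfolding is_partition_def by auto

lemma partition_unique:
  assumes "is_partition P V" "X \<in> P" "Y \<in> P" "v \<in> X" "v \<in> Y"
  shows "X = Y"
  using assms unfolding is_partition_def by auto

lemma partition_obtain:
  assumes "is_partition P V" "v \<in> V"
  obtains X where "X \<in> P" "v \<in> X"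
  using assms unfolding is_partition_def by auto

lemma finite_partition:
  assumes "is_partition P V" "finite V"
  shows "finite P"
  using assms unfolding is_partition_def by (auto intro: finite_UnionD)

definition regular_region :: "real \<Rightarrow> hg3 \<Rightarrow> nat set set \<Rightarrow> (nat \<times> nat \<times> nat) set" where
  "regular_region \<epsilon> G P =
     \<Union>{X \<times> Y \<times> Z | X Y Z. X \<in> P \<and> Y \<in> P \<and> Z \<in> P \<and> regular_triple \<epsilon> G X Y Z}"

lemma regular_region_subset:
  assumes "is_partition P V"
  shows "regular_region \<epsilon> G P \<subseteq> V \<times> V \<times> V"
  unfolding regular_region_def using partition_memD(2)[OF assms] by blast

lemma card_cube: "card (V \<times> V \<times> V) = card V ^ 3"
  by (simp add: card_cartesian_product power3_eq_cube)

text \<open>Both the upper and the lower bound count the triples outside the regular region, so the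
  condition is passed to the complement.\<close>

lemma regular_partition_iff:
  assumes "finite (fst G)"
  shows "regular_partition \<epsilon> G P \<longleftrightarrow> is_partition P (fst G) \<and>
    real (card (fst G \<times> fst G \<times> fst G - regular_region \<epsilon> G P)) \<le> \<epsilon> * real (card (fst G)) ^ 3"
proof (cases "is_partition P (fst G)")
  case True
  let ?V3 = "fst G \<times> fst G \<times> fst G" and ?R = "regular_region \<epsilon> G P"
  have sub: "?R \<subseteq> ?V3" by (rule regular_region_subset[OF True])
  have "finite ?V3" using assms by simp
  then have "card (?V3 - ?R) = card ?V3 - card ?R" "card ?R \<le> card ?V3"
    using sub by (simp_all add: card_Diff_subset finite_subset card_mono)
  then have "real (card (?V3 - ?R)) = real (card (fst G)) ^ 3 - real (card ?R)"
    by (simp add: card_cube of_nat_diff)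
  then show ?thesis
    using True unfolding regular_partition_def regular_region_def[symmetric]
    by (auto simp: algebra_simps)
qed (simp add: regular_partition_def)

section \<open>Upper bound: a regular partition with few parts\<close>

text \<open>After \<open>b\<close> and \<open>c\<close> are chosen, \<open>a\<close> must carry the
  label of \<open>b\<close>, which leaves fewer than \<open>t\<close> choices.\<close>

lemma (in tripartite) card_light_triples:
  fixes t :: real
  assumes t: "0 \<le> t"
  shows "real (card {(a, b, c). diag_triple A B C f h a b c \<and> real (card {x \<in> A. f x = f b}) < t})
    \<le> t * real (card (A \<union> B \<union> C)) ^ 2" (is "real (card ?S) \<le> _")
proof -
  let ?B = "{b \<in> B. real (card {x \<in> A. f x = f b}) < t}" and ?n = "real (card (A \<union> B \<union> C))"
  define S1 where "S1 = (SIGMA b : ?B. {x \<in> A. f x = f b} \<times> C)"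
  have fin: "finite S1"
    unfolding S1_def using finite_A finite_B finite_C by auto
  have sub: "?S \<subseteq> (\<lambda>(b, a, c). (a, b, c)) ` S1"
    unfolding S1_def diag_triple_def by force
  have "card ?S \<le> card ((\<lambda>(b, a, c). (a, b, c)) ` S1)"
    by (rule card_mono[OF _ sub]) (use fin in auto)
  also have "\<dots> \<le> card S1" by (rule card_image_le[OF fin])
  finally have "real (card ?S) \<le> real (card S1)" by linarith
  also have "\<dots> = (\<Sum>b\<in>?B. real (card {x \<in> A. f x = f b}) * real (card C))"
    unfolding S1_def using finite_A finite_B finite_C
    by (subst card_SigmaI) (auto simp: card_cartesian_product)
  also have "\<dots> \<le> (\<Sum>b\<in>?B. t * real (card C))"
    by (intro sum_mono mult_right_mono) auto
  also have "\<dots> = real (card ?B) * (t * real (card C))"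
    by simp
  also have "\<dots> \<le> ?n * (t * ?n)"
    using t finite_A finite_B finite_C by (intro mult_mono mult_left_mono) (auto intro!: card_mono)
  finally show ?thesis by (simp add: power2_eq_square mult_ac)
qed

text \<open>Rare edges are first counted in the order \<open>A\<close>, \<open>B\<close>,
  \<open>C\<close>, whereas regularity counts ordered triples of vertices in all six orders.\<close>

lemma card_symmetrized_triples:
  fixes L :: "('a \<times> 'a \<times> 'a) set"
  assumes "finite L"
  shows "card {(x, y, z). (x, y, z) \<in> L \<or> (x, z, y) \<in> L \<or> (y, x, z) \<in> L \<or> (y, z, x) \<in> L \<or>
    (z, x, y) \<in> L \<or> (z, y, x) \<in> L} \<le> 6 * card L" (is "card ?S \<le> _")
    and "finite {(x, y, z). (x, y, z) \<in> L \<or> (x, z, y) \<in> L \<or> (y, x, z) \<in> L \<or> (y, z, x) \<in> L \<or>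
    (z, x, y) \<in> L \<or> (z, y, x) \<in> L}"
proof -
  \<comment> \<open>With a list, \<open>card_length\<close> gives at most 6 maps without a proof
    that they are distinct.\<close>
  let ?F = "[\<lambda>(x, y, z). (x, y, z), \<lambda>(x, y, z). (x, z, y), \<lambda>(x, y, z). (y, x, z),
    \<lambda>(x, y, z). (z, x, y), \<lambda>(x, y, z). (y, z, x), \<lambda>(x, y, z). (z, y, x)] ::
      ('a \<times> 'a \<times> 'a \<Rightarrow> 'a \<times> 'a \<times> 'a) list"
  have sub: "?S \<subseteq> (\<Union>g\<in>set ?F. g ` L)" by force
  have fin: "finite (\<Union>g\<in>set ?F. g ` L)" using assms by auto
  show "finite ?S" by (rule finite_subset[OF sub fin])
  have "card ?S \<le> card (\<Union>g\<in>set ?F. g ` L)" by (rule card_mono[OF fin sub])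
  also have "\<dots> \<le> (\<Sum>g\<in>set ?F. card (g ` L))" by (rule card_UN_le) simp
  also have "\<dots> \<le> (\<Sum>g\<in>set ?F. card L)" by (intro sum_mono card_image_le assms)
  also have "\<dots> = card (set ?F) * card L" by simp
  also have "\<dots> \<le> 6 * card L" using card_length[of ?F] by (intro mult_right_mono) auto
  finally show "card ?S \<le> 6 * card L" .
qed

text \<open>Vertices are grouped by side and frequent labels. In an irregular box more than the
  fraction \<open>\<epsilon> ^ 4\<close> of the triples are edges, and all these edges carry rare
  labels, so they lie in \<open>S\<close>. The boxes are disjoint, hence
  \<open>\<epsilon> ^ 4\<close> times their total volume is at most the size of \<open>S\<close>,
  which is at most \<open>\<epsilon> ^ 5 * n ^ 3\<close>.\<close>

lemma (in tripartite) ex_small_regular_partition: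
  fixes \<epsilon> :: real
  assumes eps: "0 < \<epsilon>" "\<epsilon> \<le> 1"
  shows "\<exists>P. regular_partition \<epsilon> (diag_graph A B C f h) P \<and> real (card P) \<le> 3 * 2 powr (6 / \<epsilon> ^ 5)"
proof -
  let ?V = "A \<union> B \<union> C" and ?G = "diag_graph A B C f h"
  let ?T = "diag_triple A B C f h"
  let ?n = "real (card ?V)"
  \<comment> \<open>The 6 pays for the orders of a triple. In \<open>\<epsilon> ^ 5\<close> one
    factor is the allowed fraction of irregular triples and \<open>\<epsilon> ^ 4\<close> is the
    threshold of \<open>regular_triple_sparse\<close>.\<close>
  define \<eta> where "\<eta> = \<epsilon> ^ 5 / 6"
  define t where "t = \<eta> * ?n"
  have \<eta>: "0 < \<eta>" using eps by (simp add: \<eta>_def)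
  have finV: "finite ?V" using finite_A finite_B finite_C by simp
  define L where "L = {(a, b, c). ?T a b c \<and> real (card {x \<in> A. f x = f b}) < t}"
  have finL: "finite L"
    by (rule finite_subset[of _ "A \<times> B \<times> C"])
      (use finite_A finite_B finite_C in \<open>auto simp: L_def diag_triple_def\<close>)
  have cardL: "real (card L) \<le> \<eta> * ?n ^ 3"
    unfolding L_def using card_light_triples[of t f h] \<eta>
    by (simp add: t_def power2_eq_square power3_eq_cube mult_ac)
  define S where "S = {(x, y, z). (x, y, z) \<in> L \<or> (x, z, y) \<in> L \<or> (y, x, z) \<in> L \<or>
    (y, z, x) \<in> L \<or> (z, x, y) \<in> L \<or> (z, y, x) \<in> L}"
  have finS: "finite S" and "card S \<le> 6 * card L"
    unfolding S_def by (rule card_symmetrized_triples[OF finL])+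
  then have cardS: "real (card S) \<le> \<epsilon> ^ 5 * ?n ^ 3"
    using cardL by (simp add: \<eta>_def)
  define big where "big = {l \<in> f ` A. t \<le> real (card {a \<in> A. f a = l})}"
  have finbig: "finite big" unfolding big_def using finite_A by simp
  have cardbig: "real (card big) \<le> 6 / \<epsilon> ^ 5"
  proof (cases "?n = 0")
    case True
    then show ?thesis using eps finV by (simp add: big_def)
  next
    case False
    then have n: "0 < ?n" by linarith
    have "real (card big) * t = (\<Sum>l\<in>big. t)" by simp
    also have "\<dots> \<le> (\<Sum>l\<in>big. real (card {a \<in> A. f a = l}))"
      by (rule sum_mono) (simp add: big_def)
    also have "\<dots> = real (card (\<Union>l\<in>big. {a \<in> A. f a = l}))"
      using finite_A finbig by (subst card_UN_disjoint) auto
    also have "\<dots> \<le> ?n"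
      unfolding of_nat_le_iff by (rule card_mono[OF finV]) auto
    finally have "real (card big) * \<eta> * ?n \<le> 1 * ?n" by (simp add: t_def mult_ac)
    then have "real (card big) * \<eta> \<le> 1" using n mult_right_le_imp_le by blast
    then show ?thesis using eps by (simp add: \<eta>_def field_simps)
  qed
  \<comment> \<open>The first component is the side. All vertices of \<open>A\<close> with a rare
    label get the same value, since \<open>{f v} \<inter> big\<close> is then empty, and likewise in
    \<open>B\<close>; a vertex of \<open>C\<close> is known only through its frequent
    labels.\<close>
  define \<phi> where "\<phi> v = (if v \<in> A then (0 :: nat, {f v} \<inter> big) else
    if v \<in> B then (1, {f v} \<inter> big) else (2, h v \<inter> big))" for v
  define P where "P = (\<lambda>y. {v \<in> ?V. \<phi> v = y}) ` \<phi> ` ?V"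
  have part: "is_partition P ?V" unfolding P_def by (rule is_partition_fibres)
  have finP: "finite P" by (rule finite_partition[OF part finV])
  have finX: "finite X" if "X \<in> P" for X
    using partition_memD(2)[OF part that] finV by (rule finite_subset)
  have "card P \<le> card (\<phi> ` ?V)" unfolding P_def by (rule card_image_le) (use finV in simp)
  also have "\<dots> \<le> card ({0, 1, 2 :: nat} \<times> Pow big)"
    by (rule card_mono) (use finbig in \<open>auto simp: \<phi>_def\<close>)
  also have "\<dots> = 3 * 2 ^ card big" using finbig by (simp add: card_cartesian_product card_Pow)
  finally have "real (card P) \<le> real (3 * 2 ^ card big)" by (simp only: of_nat_le_iff)
  also have "\<dots> = 3 * 2 powr real (card big)" by (simp add: powr_realpow)
  also have "\<dots> \<le> 3 * 2 powr (6 / \<epsilon> ^ 5)" using cardbig by simp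
  finally have cardP: "real (card P) \<le> 3 * 2 powr (6 / \<epsilon> ^ 5)" .

  have tag: "(\<phi> v = \<phi> w \<longrightarrow> v \<in> ?V \<longrightarrow> w \<in> A \<longrightarrow> v \<in> A \<and> {f v} \<inter> big = {f w} \<inter> big) \<and>
    (\<phi> v = \<phi> w \<longrightarrow> v \<in> ?V \<longrightarrow> w \<in> B \<longrightarrow> v \<in> B \<and> {f v} \<inter> big = {f w} \<inter> big) \<and>
    (\<phi> v = \<phi> w \<longrightarrow> v \<in> ?V \<longrightarrow> w \<in> C \<longrightarrow> v \<in> C \<and> h v \<inter> big = h w \<inter> big)" for v w
    using AB AC BC by (auto simp: \<phi>_def split: if_splits)
  \<comment> \<open>An edge outside \<open>L\<close> has its label in \<open>big\<close>, and such a
    label is recovered exactly from the values of \<open>\<phi>\<close>. So the edge stays an edge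
    when its vertices move within their parts.\<close>
  have heavy: "?T a' b' c'"
    if T: "?T a b c" and nL: "(a, b, c) \<notin> L" and V: "a' \<in> ?V" "b' \<in> ?V" "c' \<in> ?V"
      and eq: "\<phi> a' = \<phi> a" "\<phi> b' = \<phi> b" "\<phi> c' = \<phi> c" for a b c a' b' c'
  proof -
    have T': "a \<in> A" "b \<in> B" "c \<in> C" "f a = f b" "f a \<in> h c" using T by (auto simp: diag_triple_def)
    have label: "l' = l" if "l \<in> big" "{l'} \<inter> big = {l} \<inter> big" for l l' :: nat
      using that by (metis IntE IntI singletonD singletonI)
    have "t \<le> real (card {x \<in> A. f x = f a})" using nL T T'(4) unfolding L_def by auto
    then have l: "f a \<in> big" unfolding big_def using imageI[OF T'(1), of f] by blast
    have mem: "a' \<in> A" "{f a'} \<inter> big = {f a} \<inter> big"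
      "b' \<in> B" "{f b'} \<inter> big = {f b} \<inter> big" "c' \<in> C" "h c' \<inter> big = h c \<inter> big"
      using tag V eq T' by blast+
    have "f a' = f a" by (rule label[OF l mem(2)])
    moreover have "f b' = f a" by (rule label[OF l]) (simp add: mem(4) T'(4))
    moreover have "f a \<in> h c'" using l mem(6) T'(5) by (metis IntE IntI)
    ultimately show ?thesis using mem unfolding diag_triple_def by simp
  qed
  \<comment> \<open>The same for unordered edges, with one use of \<open>heavy\<close> for each
    order of the three sides.\<close>
  have edge_move: "{x', y', z'} \<in> snd ?G"
    if "{x, y, z} \<in> snd ?G" "(x, y, z) \<notin> S" "x' \<in> ?V" "y' \<in> ?V" "z' \<in> ?V"
      "\<phi> x' = \<phi> x" "\<phi> y' = \<phi> y" "\<phi> z' = \<phi> z" for x y z x' y' z'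
    using that(1,2) unfolding edge_iff S_def mem_Collect_eq case_prod_conv
    using heavy[OF _ _ that(3,4,5,6,7,8)] heavy[OF _ _ that(3,5,4,6,8,7)]
      heavy[OF _ _ that(4,3,5,7,6,8)] heavy[OF _ _ that(4,5,3,7,8,6)]
      heavy[OF _ _ that(5,3,4,8,6,7)] heavy[OF _ _ that(5,4,3,8,7,6)]
    by blast

  define bad where "bad = {(X, Y, Z). X \<in> P \<and> Y \<in> P \<and> Z \<in> P \<and> \<not> regular_triple \<epsilon> ?G X Y Z}"
  define box where "box = (\<lambda>(X, Y, Z). X \<times> Y \<times> Z :: (nat \<times> nat \<times> nat) set)"
  have finbad: "finite bad"
    by (rule finite_subset[of _ "P \<times> P \<times> P"]) (use finP in \<open>auto simp: bad_def\<close>)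
  have finbox: "finite (box w)" if "w \<in> bad" for w
    using that finX by (auto simp: bad_def box_def)
  have cover: "?V \<times> ?V \<times> ?V - regular_region \<epsilon> ?G P \<subseteq> (\<Union>w\<in>bad. box w)"
  proof (rule subsetI)
    fix u assume u: "u \<in> ?V \<times> ?V \<times> ?V - regular_region \<epsilon> ?G P"
    obtain x y z where uxyz: "u = (x, y, z)" by (cases u)
    then have "x \<in> ?V" "y \<in> ?V" "z \<in> ?V" using u by auto
    then obtain X Y Z where XYZ: "X \<in> P" "x \<in> X" "Y \<in> P" "y \<in> Y" "Z \<in> P" "z \<in> Z"
      using partition_obtain[OF part] by metis
    then have "\<not> regular_triple \<epsilon> ?G X Y Z"
      using u unfolding uxyz regular_region_def by blast
    then show "u \<in> (\<Union>w\<in>bad. box w)"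
      using XYZ unfolding uxyz bad_def box_def by blast
  qed
  have disj: "box w \<inter> box w' = {}" if "w \<in> bad" "w' \<in> bad" "w \<noteq> w'" for w w'
    using that partition_unique[OF part] unfolding bad_def box_def by fastforce
  \<comment> \<open>A bad box is not sparse, which bounds its number of edges from below, and not
    full, so it has a non-edge \<open>{x', y', z'}\<close>. An edge of the box outside
    \<open>S\<close> could be moved onto this non-edge; hence all its edges lie in
    \<open>S\<close>.\<close>
  have local_bound: "real (card (box w)) * \<epsilon> ^ 4 \<le> real (card (S \<inter> box w))" if w: "w \<in> bad" for w
  proof -
    obtain X Y Z where XYZ: "w = (X, Y, Z)" "X \<in> P" "Y \<in> P" "Z \<in> P" "\<not> regular_triple \<epsilon> ?G X Y Z"
      using w unfolding bad_def by auto
    let ?e = "{(x, y, z) \<in> X \<times> Y \<times> Z. {x, y, z} \<in> snd ?G}"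
    have ne: "X \<noteq> {}" "Y \<noteq> {}" "Z \<noteq> {}" using partition_memD(1)[OF part] XYZ by auto
    have "\<epsilon> ^ 4 < density ?G X Y Z"
      using regular_triple_sparse[OF finX[OF XYZ(2)] finX[OF XYZ(3)] finX[OF XYZ(4)] eps] XYZ(5)
      by (meson not_le)
    moreover have "0 < real (card X) * real (card Y) * real (card Z)"
      using ne finX XYZ by (simp add: card_gt_0_iff)
    ultimately have "\<epsilon> ^ 4 * (real (card X) * real (card Y) * real (card Z)) \<le> real (card ?e)"
      unfolding density_def by (simp add: pos_less_divide_eq less_imp_le)
    then have 1: "real (card (box w)) * \<epsilon> ^ 4 \<le> real (card ?e)"
      by (simp add: XYZ(1) box_def card_cartesian_product mult_ac)
    obtain x' y' z' where x': "x' \<in> X" "y' \<in> Y" "z' \<in> Z" "{x', y', z'} \<notin> snd ?G"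
      using regular_triple_full[OF finX[OF XYZ(2)] finX[OF XYZ(3)] finX[OF XYZ(4)] ne eps(1)] XYZ(5)
      by metis
    have same: "\<phi> v = \<phi> v'" "v' \<in> ?V" if "W \<in> P" "v \<in> W" "v' \<in> W" for v v' W
      using that unfolding P_def by auto
    have "?e \<subseteq> S \<inter> box w"
    proof (rule subsetI)
      fix u assume "u \<in> ?e"
      then obtain x y z where u: "u = (x, y, z)" "x \<in> X" "y \<in> Y" "z \<in> Z" "{x, y, z} \<in> snd ?G"
        by blast
      have "(x, y, z) \<in> S"
      proof (rule ccontr)
        assume "(x, y, z) \<notin> S"
        from edge_move[OF u(5) this, of x' y' z'] have "{x', y', z'} \<in> snd ?G"
          using same[OF XYZ(2) x'(1) u(2)] same[OF XYZ(3) x'(2) u(3)] same[OF XYZ(4) x'(3) u(4)]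
            same[OF XYZ(2) u(2) x'(1)] same[OF XYZ(3) u(3) x'(2)] same[OF XYZ(4) u(4) x'(3)] by blast
        with x'(4) show False by contradiction
      qed
      then show "u \<in> S \<inter> box w" using u by (simp add: XYZ(1) box_def)
    qed
    then have "card ?e \<le> card (S \<inter> box w)" using finS by (intro card_mono) auto
    with 1 show ?thesis by linarith
  qed
  have "real (card (?V \<times> ?V \<times> ?V - regular_region \<epsilon> ?G P)) \<le> real (card (\<Union>w\<in>bad. box w))"
    unfolding of_nat_le_iff by (rule card_mono[OF _ cover]) (use finbad finbox in auto)
  also have "\<dots> \<le> real (\<Sum>w\<in>bad. card (box w))"
    unfolding of_nat_le_iff by (rule card_UN_le[OF finbad])
  finally have "real (card (?V \<times> ?V \<times> ?V - regular_region \<epsilon> ?G P)) * \<epsilon> ^ 4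
      \<le> (\<Sum>w\<in>bad. real (card (box w))) * \<epsilon> ^ 4"
    using eps by (intro mult_right_mono) auto
  also have "\<dots> \<le> (\<Sum>w\<in>bad. real (card (S \<inter> box w)))"
    unfolding sum_distrib_right by (intro sum_mono local_bound)
  also have "\<dots> = real (card (\<Union>w\<in>bad. S \<inter> box w))"
  proof -
    have "(S \<inter> box w) \<inter> (S \<inter> box w') = {}" if "w \<in> bad" "w' \<in> bad" "w \<noteq> w'" for w w'
      using disj[OF that] by blast
    then show ?thesis using finbad finS by (subst card_UN_disjoint) simp_all
  qed
  also have "\<dots> \<le> real (card S)"
    unfolding of_nat_le_iff by (rule card_mono[OF finS]) auto
  also have "\<dots> \<le> (\<epsilon> * ?n ^ 3) * \<epsilon> ^ 4" using cardS by (simp add: eval_nat_numeral mult_ac)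
  finally have "real (card (?V \<times> ?V \<times> ?V - regular_region \<epsilon> ?G P)) \<le> \<epsilon> * ?n ^ 3"
    using eps by simp
  then have "regular_partition \<epsilon> ?G P"
    using finV part by (subst regular_partition_iff) simp_all
  with cardP show ?thesis by blast
qed

section \<open>Lower bound: a regular partition must recover most label sets\<close>

text \<open>These are the vertices given up: a vertex of \<open>W\<close> outside the minority lies
  in a part \<open>X\<close> for which \<open>X \<inter> W\<close> is large enough to serve as a
  test set for regularity.\<close>

definition minority :: "real \<Rightarrow> nat set set \<Rightarrow> nat set \<Rightarrow> nat set" where
  "minority \<epsilon> P W = {v \<in> W. \<exists>X\<in>P. v \<in> X \<and> real (card (X \<inter> W)) < \<epsilon> * real (card X)}"

text \<open>Each part \<open>X\<close> contributes fewer than \<open>\<epsilon> * card X\<close>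
  vertices or none, and the parts are disjoint.\<close>

lemma card_minority:
  assumes part: "is_partition P V" and fin: "finite V" and eps: "0 \<le> \<epsilon>"
  shows "real (card (minority \<epsilon> P W)) \<le> \<epsilon> * real (card V)"
proof -
  let ?P = "{X \<in> P. real (card (X \<inter> W)) < \<epsilon> * real (card X)}"
  have finP: "finite P" by (rule finite_partition[OF part fin])
  have finX: "finite X" if "X \<in> P" for X
    using partition_memD(2)[OF part that] fin by (rule finite_subset)
  have fin': "finite (\<Union>X\<in>?P. X \<inter> W)"
    by (rule finite_UN_I) (use finP finX in auto)
  have "card (minority \<epsilon> P W) \<le> card (\<Union>X\<in>?P. X \<inter> W)"
    unfolding minority_def by (rule card_mono[OF fin']) auto
  also have "\<dots> \<le> (\<Sum>X\<in>?P. card (X \<inter> W))" by (rule card_UN_le) (use finP in simp)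
  finally have "real (card (minority \<epsilon> P W)) \<le> (\<Sum>X\<in>?P. real (card (X \<inter> W)))"
    unfolding of_nat_sum[symmetric] of_nat_le_iff .
  also have "\<dots> \<le> (\<Sum>X\<in>?P. \<epsilon> * real (card X))" by (rule sum_mono) simp
  also have "\<dots> \<le> (\<Sum>X\<in>P. \<epsilon> * real (card X))"
    by (rule sum_mono2) (use finP eps in auto)
  also have "\<dots> = \<epsilon> * real (\<Sum>X\<in>P. card X)" by (simp add: sum_distrib_left)
  also have "(\<Sum>X\<in>P. card X) = card (\<Union>P)"
    using part finX by (intro card_Union_disjoint[symmetric]) (auto simp: is_partition_def pairwise_def disjnt_def)
  also have "\<Union>P = V" using part by (simp add: is_partition_def)
  finally show ?thesis .
qed

lemma finite_minority: "finite W \<Longrightarrow> finite (minority \<epsilon> P W)"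
  by (rule finite_subset[of _ W]) (auto simp: minority_def)

lemma minority_subset: "minority \<epsilon> P W \<subseteq> W"
  by (auto simp: minority_def)

lemma majority_le:
  assumes "v \<in> W - minority \<epsilon> P W" "X \<in> P" "v \<in> X"
  shows "\<epsilon> * real (card X) \<le> real (card (X \<inter> W))"
  using assms by (auto simp: minority_def not_less)

text \<open>If a part of \<open>C\<close> is mixed with respect to a label \<open>i\<close>,
  regularity fails against parts rich in label \<open>i\<close> on the sides \<open>A\<close> and
  \<open>B\<close>; so few vertices of \<open>C\<close> lie in mixed parts. For at least half of
  \<open>C\<close> the part therefore determines \<open>h c\<close>. As each label set occurs on
  only the fraction \<open>2 ^ -k\<close> of \<open>C\<close>, this takes at least
  \<open>2 ^ (k - 1)\<close> parts.\<close>

lemma (in tripartite) exp_le_card_regular_partition: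
  fixes \<epsilon> :: real and k l :: nat
  assumes k: "1 \<le> k" and l: "1 \<le> l"
    and card_C: "card C = l" and card_V: "card (A \<union> B \<union> C) = 3 * l"
    and fibre_A: "\<And>i. i < k \<Longrightarrow> k * card {a \<in> A. f a = i} = l"
    and fibre_B: "\<And>i. i < k \<Longrightarrow> k * card {b \<in> B. f b = i} = l"
    and fibre_C: "\<And>S. S \<subseteq> {..<k} \<Longrightarrow> 2 ^ k * card {c \<in> C. h c = S} = l"
    and h_sub: "\<And>c. c \<in> C \<Longrightarrow> h c \<subseteq> {..<k}"
    and eps: "0 < \<epsilon>" "228 * real k ^ 3 * \<epsilon> \<le> 1"
    and reg: "regular_partition \<epsilon> (diag_graph A B C f h) P"
  shows "2 ^ k \<le> 2 * card P"
proof -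
  let ?V = "A \<union> B \<union> C" and ?G = "diag_graph A B C f h"
  let ?Fa = "\<lambda>i. {a \<in> A. f a = i}" and ?Fb = "\<lambda>i. {b \<in> B. f b = i}"
  let ?In = "\<lambda>i. {c \<in> C. i \<in> h c}" and ?Out = "\<lambda>i. {c \<in> C. i \<notin> h c}"
  have finV: "finite ?V" using finite_A finite_B finite_C by simp
  have part: "is_partition P ?V"
    and irr: "real (card (?V \<times> ?V \<times> ?V - regular_region \<epsilon> ?G P)) \<le> \<epsilon> * real (3 * l) ^ 3"
    using reg finV by (simp_all add: regular_partition_iff card_V)
  have finP: "finite P" by (rule finite_partition[OF part finV])
  have finX: "finite X" if "X \<in> P" for X
    using partition_memD(2)[OF part that] finV by (rule finite_subset)
  have minor: "real (card (minority \<epsilon> P W)) \<le> 3 * \<epsilon> * real l" for W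
    using card_minority[OF part finV, of \<epsilon> W] eps by (simp add: card_V)
  have K: "1 \<le> real k" "0 < real l" using k l by simp_all
  have k3: "real k \<le> real k ^ 3" using K(1) by (simp add: self_le_power)
  have eps_small: "228 * real k * \<epsilon> \<le> 1"
  proof -
    have "228 * real k * \<epsilon> \<le> 228 * real k ^ 3 * \<epsilon>"
      by (intro mult_right_mono mult_left_mono k3) (use eps in auto)
    with eps(2) show ?thesis by linarith
  qed
  have eps_half: "\<epsilon> < 1 / 2"
  proof -
    have "228 * 1 * \<epsilon> \<le> 228 * real k * \<epsilon>"
      by (intro mult_right_mono mult_left_mono K) (use eps in auto)
    with eps_small show ?thesis by linarith
  qed
  \<comment> \<open>A label class has \<open>l / k\<close> vertices, and its minority removes at
    most \<open>3 * \<epsilon> * l\<close>, which is at most half of that.\<close>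
  have major: "real l / (2 * real k) \<le> real (card (W - minority \<epsilon> P W))"
    if "k * card W = l" "finite W" for W
  proof -
    have "card (W - minority \<epsilon> P W) = card W - card (minority \<epsilon> P W)"
      "card (minority \<epsilon> P W) \<le> card W"
      using that(2) by (simp_all add: card_Diff_subset finite_minority minority_subset card_mono)
    then have "real (card (W - minority \<epsilon> P W)) = real (card W) - real (card (minority \<epsilon> P W))"
      by (simp add: of_nat_diff)
    moreover have "real (card W) = real l / real k"
      using that(1) K by (simp add: field_simps flip: of_nat_mult)
    moreover have "3 * \<epsilon> * real l \<le> real l / (2 * real k)"
    proof -
      have "(6 * real k * \<epsilon>) * real l \<le> 1 * real l"
        using eps_small K eps by (intro mult_right_mono) auto
      then show ?thesis using K by (simp add: field_simps)
    qed
    moreover have "real l / real k = real l / (2 * real k) + real l / (2 * real k)"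
      using K by (simp add: field_simps)
    ultimately show ?thesis using minor[of W] by linarith
  qed

  \<comment> \<open>The vertices of \<open>C\<close> whose part is mixed for label \<open>i\<close>:
    those with the label and those without it both form admissible test sets.\<close>
  define D where "D i = {c \<in> C. \<exists>Z\<in>P. c \<in> Z \<and> \<epsilon> * real (card Z) \<le> real (card (Z \<inter> ?In i)) \<and>
    \<epsilon> * real (card Z) \<le> real (card (Z \<inter> ?Out i))}" for i
  have finD: "finite (D i)" for i unfolding D_def using finite_C by simp
  \<comment> \<open>Label \<open>i\<close> on both \<open>?X\<close> and \<open>?Y\<close> makes the
    density 1 against \<open>?In i\<close> and 0 against \<open>?Out i\<close>. Regularity would put
    both within \<open>\<epsilon> < 1 / 2\<close> of one number.\<close>
  have irregular: "(a, b, c) \<notin> regular_region \<epsilon> ?G P"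
    if a: "a \<in> ?Fa i - minority \<epsilon> P (?Fa i)" and b: "b \<in> ?Fb i - minority \<epsilon> P (?Fb i)"
      and c: "c \<in> D i" for i a b c
  proof
    assume "(a, b, c) \<in> regular_region \<epsilon> ?G P"
    then obtain X Y Z where XYZ: "X \<in> P" "Y \<in> P" "Z \<in> P" "a \<in> X" "b \<in> Y" "c \<in> Z"
      and r: "regular_triple \<epsilon> ?G X Y Z"
      unfolding regular_region_def by blast
    let ?X = "X \<inter> ?Fa i" and ?Y = "Y \<inter> ?Fb i"
    have "\<epsilon> * real (card X) \<le> real (card ?X)" "\<epsilon> * real (card Y) \<le> real (card ?Y)"
      using majority_le[OF a XYZ(1,4)] majority_le[OF b XYZ(2,5)] .
    moreover have "\<epsilon> * real (card Z) \<le> real (card (Z \<inter> ?In i))"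
      "\<epsilon> * real (card Z) \<le> real (card (Z \<inter> ?Out i))"
      using c partition_unique[OF part _ XYZ(3) _ XYZ(6)] unfolding D_def by auto
    moreover note ge = calculation
    have dens: "density ?G ?X ?Y (Z \<inter> W) = of_bool \<beta>"
      if "\<epsilon> * real (card Z) \<le> real (card (Z \<inter> W))" "\<And>c. c \<in> W \<Longrightarrow> c \<in> C \<and> (i \<in> h c \<longleftrightarrow> \<beta>)" for W \<beta>
    proof (rule density_const)
      show "?X \<noteq> {}"
        using nonempty_of_card_ge[OF finX[OF XYZ(1)] _ eps(1) ge(1)] XYZ(4) by blast
      show "?Y \<noteq> {}"
        using nonempty_of_card_ge[OF finX[OF XYZ(2)] _ eps(1) ge(2)] XYZ(5) by blast
      show "Z \<inter> W \<noteq> {}"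
        using nonempty_of_card_ge[OF finX[OF XYZ(3)] _ eps(1) that(1)] XYZ(6) by blast
      show "finite ?X" "finite ?Y" "finite (Z \<inter> W)" using finX XYZ by auto
      show "{x, y, z} \<in> snd ?G \<longleftrightarrow> \<beta>" if "x \<in> ?X" "y \<in> ?Y" "z \<in> Z \<inter> W" for x y z
        using that \<open>\<And>c. c \<in> W \<Longrightarrow> c \<in> C \<and> (i \<in> h c \<longleftrightarrow> \<beta>)\<close>[of z] edge_ABC[of x y z f h] by auto
    qed
    have close: "\<bar>density ?G X Y Z - density ?G ?X ?Y (Z \<inter> W)\<bar> \<le> \<epsilon>"
      if "\<epsilon> * real (card Z) \<le> real (card (Z \<inter> W))" for W
      using r that ge(1,2) unfolding regular_triple_def by (meson Int_lower1)
    have "\<bar>density ?G X Y Z - of_bool True\<bar> \<le> \<epsilon>"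
      using close[OF ge(3)] dens[OF ge(3), of True] by simp
    moreover have "\<bar>density ?G X Y Z - of_bool False\<bar> \<le> \<epsilon>"
      using close[OF ge(4)] dens[OF ge(4), of False] by simp
    ultimately show False using eps_half by simp
  qed
  have cardD: "real (card (D i)) \<le> 108 * real k ^ 2 * \<epsilon> * real l" if i: "i < k" for i
  proof -
    let ?A = "?Fa i - minority \<epsilon> P (?Fa i)" and ?B = "?Fb i - minority \<epsilon> P (?Fb i)"
    have "?A \<times> ?B \<times> D i \<subseteq> ?V \<times> ?V \<times> ?V - regular_region \<epsilon> ?G P"
      using irregular unfolding D_def by blast
    then have "card (?A \<times> ?B \<times> D i) \<le> card (?V \<times> ?V \<times> ?V - regular_region \<epsilon> ?G P)"
      using finV by (intro card_mono) auto
    then have "real (card (?A \<times> ?B \<times> D i)) \<le> \<epsilon> * real (3 * l) ^ 3" using irr by linarith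
    then have le: "real (card ?A) * (real (card ?B) * real (card (D i))) \<le> \<epsilon> * real (3 * l) ^ 3"
      by (simp add: card_cartesian_product)
    let ?q = "real l / (2 * real k)"
    have "?q * (?q * real (card (D i))) \<le> real (card ?A) * (real (card ?B) * real (card (D i)))"
      using major[OF fibre_A[OF i]] major[OF fibre_B[OF i]] finite_A finite_B
      by (intro mult_mono) auto
    with le have "?q * (?q * real (card (D i))) \<le> \<epsilon> * real (3 * l) ^ 3" by linarith
    \<comment> \<open>The constant is 108 = 4 * 27: \<open>?q ^ 2\<close> contributes the 4, and the
      cube of \<open>3 * l\<close> the 27.\<close>
    then have "real l ^ 2 * real (card (D i)) \<le> real l ^ 2 * (108 * real k ^ 2 * \<epsilon> * real l)"
      using K by (simp add: field_simps power2_eq_square power3_eq_cube)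
    then show ?thesis using K by (simp add: mult_le_cancel_left_pos)
  qed

  \<comment> \<open>\<open>v Z\<close> is the label set read off from the part \<open>Z\<close>. It
    is correct for every vertex of \<open>C\<close> in \<open>Z\<close> outside
    \<open>wrong\<close>.\<close>
  define v where "v Z = {i. i < k \<and> \<epsilon> * real (card Z) \<le> real (card (Z \<inter> ?In i))}" for Z
  define wrong where "wrong = (\<Union>i<k. D i \<union> minority \<epsilon> P (?In i) \<union> minority \<epsilon> P (?Out i))"
  have finwrong: "finite wrong"
    unfolding wrong_def using finD finite_C by (auto intro!: finite_minority)
  have right: "h c \<in> v ` P" if c: "c \<in> C" "c \<notin> wrong" for c
  proof -
    obtain Z where Z: "Z \<in> P" "c \<in> Z" using partition_obtain[OF part, of c] c(1) by blast
    have "i \<in> h c \<longleftrightarrow> i \<in> v Z" if i: "i < k" for i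
    proof
      assume "i \<in> h c"
      then have "c \<in> ?In i - minority \<epsilon> P (?In i)" using c i unfolding wrong_def by auto
      from majority_le[OF this Z] show "i \<in> v Z" using i by (simp add: v_def)
    next
      assume vi: "i \<in> v Z"
      show "i \<in> h c"
      proof (rule ccontr)
        assume "i \<notin> h c"
        then have "c \<in> ?Out i - minority \<epsilon> P (?Out i)" using c i unfolding wrong_def by auto
        from majority_le[OF this Z] have "c \<in> D i"
          using vi Z c(1) unfolding D_def v_def by blast
        with c i show False unfolding wrong_def by blast
      qed
    qed
    then have "h c = v Z" using h_sub[OF c(1)] unfolding v_def by blast
    with Z(1) show ?thesis by blast
  qed
  have "real (card wrong) \<le> (\<Sum>i<k. real (card (D i \<union> minority \<epsilon> P (?In i) \<union> minority \<epsilon> P (?Out i))))"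
    unfolding wrong_def of_nat_sum[symmetric] of_nat_le_iff by (rule card_UN_le) simp
  \<comment> \<open>108 from the mixed parts plus 3 for each of the two minorities. Summing over
    \<open>k\<close> labels gives half of 228, whence the hypothesis on
    \<open>\<epsilon>\<close>.\<close>
  also have "\<dots> \<le> (\<Sum>i<k. 114 * real k ^ 2 * \<epsilon> * real l)"
  proof (rule sum_mono)
    fix i assume "i \<in> {..<k}"
    then have i: "i < k" by simp
    have "card (D i \<union> minority \<epsilon> P (?In i) \<union> minority \<epsilon> P (?Out i))
      \<le> card (D i) + card (minority \<epsilon> P (?In i)) + card (minority \<epsilon> P (?Out i))"
      by (meson add_le_mono1 card_Un_le order_trans)
    then have "real (card (D i \<union> minority \<epsilon> P (?In i) \<union> minority \<epsilon> P (?Out i)))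
      \<le> 108 * real k ^ 2 * \<epsilon> * real l + 6 * \<epsilon> * real l"
      using cardD[OF i] minor[of "?In i"] minor[of "?Out i"] by linarith
    also have "6 * \<epsilon> * real l \<le> real k ^ 2 * (6 * \<epsilon> * real l)"
    proof -
      have "1 * (6 * \<epsilon> * real l) \<le> real k ^ 2 * (6 * \<epsilon> * real l)"
        using K eps by (intro mult_right_mono) (auto simp: one_le_power)
      then show ?thesis by simp
    qed
    finally show "real (card (D i \<union> minority \<epsilon> P (?In i) \<union> minority \<epsilon> P (?Out i)))
      \<le> 114 * real k ^ 2 * \<epsilon> * real l" by (simp add: algebra_simps)
  qed
  also have "\<dots> = (228 * real k ^ 3 * \<epsilon>) * real l / 2"
    by (simp add: power2_eq_square power3_eq_cube)
  also have "\<dots> \<le> real l / 2"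
    using mult_right_mono[OF eps(2), of "real l"] by linarith
  finally have wrong: "real (card wrong) \<le> real l / 2" .

  have "C \<subseteq> wrong \<union> (\<Union>S\<in>v ` P. {c \<in> C. h c = S})"
  proof
    fix c assume "c \<in> C"
    then show "c \<in> wrong \<union> (\<Union>S\<in>v ` P. {c \<in> C. h c = S})"
      using right[of c] by (cases "c \<in> wrong") (simp_all add: image_iff)
  qed
  then have "card C \<le> card (wrong \<union> (\<Union>S\<in>v ` P. {c \<in> C. h c = S}))"
    using finwrong finP finite_C by (intro card_mono) auto
  also have "\<dots> \<le> card wrong + card (\<Union>S\<in>v ` P. {c \<in> C. h c = S})" by (rule card_Un_le)
  also have "card (\<Union>S\<in>v ` P. {c \<in> C. h c = S}) \<le> (\<Sum>S\<in>v ` P. card {c \<in> C. h c = S})"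
    by (rule card_UN_le) (use finP in simp)
  finally have "real l \<le> real (card wrong) + real (\<Sum>S\<in>v ` P. card {c \<in> C. h c = S})"
    unfolding card_C of_nat_add[symmetric] of_nat_le_iff by simp
  with wrong have "real l \<le> 2 * real (\<Sum>S\<in>v ` P. card {c \<in> C. h c = S})" by linarith
  then have "l \<le> 2 * (\<Sum>S\<in>v ` P. card {c \<in> C. h c = S})" by linarith
  \<comment> \<open>Scaling by \<open>2 ^ k\<close> makes each label set contribute exactly
    \<open>l\<close>; \<open>v Z\<close> is a subset of \<open>{..<k}\<close>, as
    \<open>fibre_C\<close> requires.\<close>
  then have "2 ^ k * l \<le> 2 * (\<Sum>S\<in>v ` P. 2 ^ k * card {c \<in> C. h c = S})"
    by (simp add: sum_distrib_left[symmetric] mult.left_commute)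
  also have "(\<Sum>S\<in>v ` P. 2 ^ k * card {c \<in> C. h c = S}) = (\<Sum>S\<in>v ` P. l)"
    by (rule sum.cong) (auto intro!: fibre_C simp: v_def)
  also have "\<dots> = card (v ` P) * l" by simp
  also have "\<dots> \<le> card P * l" by (intro mult_right_mono card_image_le finP) simp
  finally have "2 ^ k * l \<le> (2 * card P) * l" by (simp add: mult_ac)
  then show ?thesis using l by simp
qed

section \<open>Balanced blowups\<close>

text \<open>\<open>t\<close> is the side, \<open>i\<close> the code of a label or of a set of
  labels, and \<open>s\<close> the copy number; the coding makes the three sides disjoint.\<close>

definition vertex :: "nat \<Rightarrow> nat \<Rightarrow> nat \<Rightarrow> nat" where
  "vertex t i s = prod_encode (t, prod_encode (i, s))"

definition vlabel :: "nat \<Rightarrow> nat" where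
  "vlabel v = fst (prod_decode (snd (prod_decode v)))"

definition vcopy :: "nat \<Rightarrow> nat" where
  "vcopy v = snd (prod_decode (snd (prod_decode v)))"

lemma vlabel_vertex [simp]: "vlabel (vertex t i s) = i"
  by (simp add: vlabel_def vertex_def)

lemma vcopy_vertex [simp]: "vcopy (vertex t i s) = s"
  by (simp add: vcopy_def vertex_def)

lemma vertex_eq_iff [simp]: "vertex t i s = vertex t' i' s' \<longleftrightarrow> t = t' \<and> i = i' \<and> s = s'"
  by (auto simp: vertex_def prod_encode_eq)

text \<open>The copy numbers are chosen so that the three sides have the same size \<open>k * 2 ^ k * m\<close>.\<close>

definition blow_A :: "nat \<Rightarrow> nat \<Rightarrow> nat set" where
  "blow_A k m = (\<lambda>(i, s). vertex 0 i s) ` ({..<k} \<times> {..<2 ^ k * m})"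

definition blow_B :: "nat \<Rightarrow> nat \<Rightarrow> nat set" where
  "blow_B k m = (\<lambda>(i, s). vertex 1 i s) ` ({..<k} \<times> {..<2 ^ k * m})"

definition blow_C :: "nat \<Rightarrow> nat \<Rightarrow> nat set" where
  "blow_C k m = (\<lambda>(S, u). vertex 2 (set_encode S) u) ` (Pow {..<k} \<times> {..<k * m})"

definition blowup :: "nat \<Rightarrow> nat \<Rightarrow> hg3" where
  "blowup k m = diag_graph (blow_A k m) (blow_B k m) (blow_C k m) vlabel (\<lambda>v. set_decode (vlabel v))"

lemma tripartite_blow: "tripartite (blow_A k m) (blow_B k m) (blow_C k m)"
  by unfold_locales (auto simp: blow_A_def blow_B_def blow_C_def)

lemma blowup_in_class: "blowup k m \<in> diag_class"
  unfolding blowup_def by (rule diag_classI[OF tripartite_blow])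

lemma finite_of_subset_lessThan: "S \<subseteq> {..<k :: nat} \<Longrightarrow> finite S"
  by (rule finite_subset) auto

lemma inj_on_blow_C: "inj_on (\<lambda>(S, u). vertex 2 (set_encode S) u) (Pow {..<k} \<times> {..<k * m})"
proof (rule inj_onI, clarsimp)
  fix S T assume "S \<subseteq> {..<k}" "T \<subseteq> {..<k}" "set_encode S = set_encode T"
  then show "S = T"
    by (metis finite_of_subset_lessThan set_encode_inverse)
qed

lemma card_blow_A: "card (blow_A k m) = k * 2 ^ k * m"
  unfolding blow_A_def by (subst card_image) (auto simp: inj_on_def card_cartesian_product)

lemma card_blow_B: "card (blow_B k m) = k * 2 ^ k * m"
  unfolding blow_B_def by (subst card_image) (auto simp: inj_on_def card_cartesian_product)

lemma card_blow_C: "card (blow_C k m) = k * 2 ^ k * m"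
  unfolding blow_C_def
  by (subst card_image[OF inj_on_blow_C]) (simp add: card_cartesian_product card_Pow)

lemma card_blow: "card (blow_A k m \<union> blow_B k m \<union> blow_C k m) = 3 * (k * 2 ^ k * m)"
proof -
  interpret tripartite "blow_A k m" "blow_B k m" "blow_C k m" by (rule tripartite_blow)
  have "(blow_A k m \<union> blow_B k m) \<inter> blow_C k m = {}" using AC BC by blast
  then show ?thesis
    using finite_A finite_B finite_C AB
    by (simp add: card_Un_disjoint card_blow_A card_blow_B card_blow_C)
qed

lemma card_fibre_blow_A: "i < k \<Longrightarrow> card {a \<in> blow_A k m. vlabel a = i} = 2 ^ k * m"
proof -
  assume "i < k"
  then have "{a \<in> blow_A k m. vlabel a = i} = vertex 0 i ` {..<2 ^ k * m}"
    by (auto simp: blow_A_def)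
  then show ?thesis by (simp add: card_image inj_on_def)
qed

lemma card_fibre_blow_B: "i < k \<Longrightarrow> card {b \<in> blow_B k m. vlabel b = i} = 2 ^ k * m"
proof -
  assume "i < k"
  then have "{b \<in> blow_B k m. vlabel b = i} = vertex 1 i ` {..<2 ^ k * m}"
    by (auto simp: blow_B_def)
  then show ?thesis by (simp add: card_image inj_on_def)
qed

lemma card_fibre_blow_C:
  "S \<subseteq> {..<k} \<Longrightarrow> card {c \<in> blow_C k m. set_decode (vlabel c) = S} = k * m"
proof -
  assume "S \<subseteq> {..<k}"
  then have "{c \<in> blow_C k m. set_decode (vlabel c) = S} = vertex 2 (set_encode S) ` {..<k * m}"
    by (auto simp: blow_C_def finite_of_subset_lessThan)
  then show ?thesis by (simp add: card_image inj_on_def)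
qed

text \<open>The bound does not depend on \<open>m\<close>, so it holds for arbitrarily large members
  of the class, the only ones that \<open>reg_bound\<close> sees.\<close>

lemma blowup_regular_partition_large:
  assumes k: "1 \<le> k" and m: "1 \<le> m" and eps: "0 < \<epsilon>" "228 * real k ^ 3 * \<epsilon> \<le> 1"
    and reg: "regular_partition \<epsilon> (blowup k m) P"
  shows "2 ^ k \<le> 2 * card P"
proof (rule tripartite.exp_le_card_regular_partition[OF tripartite_blow k _ card_blow_C card_blow
      _ _ _ _ eps reg[unfolded blowup_def]])
  show "1 \<le> k * 2 ^ k * m" using k m by simp
  show "k * card {a \<in> blow_A k m. vlabel a = i} = k * 2 ^ k * m" if "i < k" for i
    using that by (simp add: card_fibre_blow_A)
  show "k * card {b \<in> blow_B k m. vlabel b = i} = k * 2 ^ k * m" if "i < k" for i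
    using that by (simp add: card_fibre_blow_B)
  show "2 ^ k * card {c \<in> blow_C k m. set_decode (vlabel c) = S} = k * 2 ^ k * m"
    if "S \<subseteq> {..<k}" for S
    using that by (simp add: card_fibre_blow_C)
  show "set_decode (vlabel c) \<subseteq> {..<k}" if "c \<in> blow_C k m" for c
    using that by (auto simp: blow_C_def finite_of_subset_lessThan)
qed

lemma blowup_edge:
  assumes "i < k" "s < 2 ^ k * m" "t < 2 ^ k * m" "S \<subseteq> {..<k}" "u < k * m"
  shows "{vertex 0 i s, vertex 1 i t, vertex 2 (set_encode S) u} \<in> snd (blowup k m) \<longleftrightarrow> i \<in> S"
proof -
  have "vertex 0 i s \<in> blow_A k m" "vertex 1 i t \<in> blow_B k m"
    "vertex 2 (set_encode S) u \<in> blow_C k m"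
    using assms unfolding blow_A_def blow_B_def blow_C_def by auto
  then show ?thesis
    unfolding blowup_def using assms(4)
    by (simp add: tripartite.edge_ABC[OF tripartite_blow] finite_of_subset_lessThan)
qed

section \<open>Distance from finite VC-dimension\<close>

lemma finite_ord_edges:
  assumes "is_3graph G"
  shows "finite (ord_edges G)"
proof (rule finite_subset)
  show "ord_edges G \<subseteq> fst G \<times> fst G \<times> fst G"
    using assms unfolding ord_edges_def is_3graph_def by auto
  show "finite (fst G \<times> fst G \<times> fst G)" using assms unfolding is_3graph_def by simp
qed

text \<open>The triples \<open>(s, t, u)\<close> of copy numbers give \<open>(2 ^ k * m) ^ 2 * (k * m)\<close> disjoint
  systems of triples, each of which would witness that \<open>G\<close> shatters \<open>k\<close> pairs unless \<open>G\<close>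
  disagrees with the blowup on it.\<close>

lemma blowup_far_from_non_shattering:
  assumes G: "is_3graph G" "fst G = fst (blowup k m)" and ns: "\<not> hg_shatters G k"
  shows "2 ^ k * m * (2 ^ k * m * (k * m)) \<le>
    card (ord_edges (blowup k m) - ord_edges G \<union> (ord_edges G - ord_edges (blowup k m)))"
    (is "_ \<le> card ?D")
proof -
  let ?Box = "{..<2 ^ k * m} \<times> {..<2 ^ k * m} \<times> {..<k * m}"
  let ?pr = "\<lambda>(x, y, z). (vcopy x, vcopy y, vcopy z)"
  have fin: "finite ?D"
    using G(1) hereditary_diag_class blowup_in_class finite_ord_edges
    unfolding hereditary_def by blast
  \<comment> \<open>Every triple of copy numbers is the projection of a disagreement, so there are
    at least as many disagreements as such triples.\<close>
  have "?Box \<subseteq> ?pr ` ?D"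
  proof
    fix w assume "w \<in> ?Box"
    then obtain s t u where w: "w = (s, t, u)" and
      stu: "s < 2 ^ k * m" "t < 2 ^ k * m" "u < k * m" by auto
    \<comment> \<open>Shattering is indexed by \<open>{1..k}\<close> and labels by
      \<open>{..<k}\<close>, hence the shift. Truncated subtraction is injective here because all
      indices are at least 1.\<close>
    let ?p = "\<lambda>S. (\<lambda>i. i - 1) ` S :: nat set"
    define a b c where "a i = vertex 0 (i - 1) s" and "b i = vertex 1 (i - 1) t"
      and "c S = vertex 2 (set_encode (?p S)) u" for i :: nat and S :: "nat set"
    have sub: "?p S \<subseteq> {..<k}" if "S \<subseteq> {1..k}" for S using that by fastforce
    have "a i \<in> fst G \<and> b i \<in> fst G" if "i \<in> {1..k}" for i
    proof -
      have "i - 1 < k" using that by auto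
      then show ?thesis
        using stu unfolding G(2) blowup_def a_def b_def blow_A_def blow_B_def by auto
    qed
    moreover have "c S \<in> fst G" if "S \<subseteq> {1..k}" for S
      using sub[OF that] stu unfolding G(2) blowup_def c_def blow_C_def by auto
    ultimately obtain i S where iS: "i \<in> {1..k}" "S \<subseteq> {1..k}"
      and ne: "({a i, b i, c S} \<in> snd G) \<noteq> (i \<in> S)"
      using ns unfolding hg_shatters_def by metis
    have mem: "i - 1 \<in> ?p S \<longleftrightarrow> i \<in> S"
    proof
      assume "i - 1 \<in> ?p S"
      then obtain j where "j \<in> S" "i - 1 = j - 1" by auto
      moreover from this iS have "1 \<le> j" "1 \<le> i" by auto
      ultimately show "i \<in> S" by (metis diff_add)
    qed simp
    have "i - 1 < k" using iS(1) by auto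
    then have "{a i, b i, c S} \<in> snd (blowup k m) \<longleftrightarrow> i \<in> S"
      unfolding a_def b_def c_def
      using blowup_edge[of "i - 1" k s m t "?p S" u] stu sub[OF iS(2)] mem by simp
    with ne have "(a i, b i, c S) \<in> ?D" unfolding ord_edges_def by auto
    moreover have "w = ?pr (a i, b i, c S)" by (simp add: w a_def b_def c_def)
    ultimately show "w \<in> ?pr ` ?D" by (rule rev_image_eqI)
  qed
  then have "card ?Box \<le> card ?D" by (rule surj_card_le[OF fin])
  then show ?thesis by (simp add: card_cartesian_product)
qed

text \<open>If the VC-dimension of the approximating property is \<open>d\<close>, its members
  cannot shatter \<open>d + 1\<close> pairs. They differ from a blowup by a fraction of the ordered
  triples that does not depend on \<open>m\<close>.\<close>

lemma far_diag_class: "far_from_finite_vc diag_class"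
  unfolding far_from_finite_vc_def
proof
  assume "\<exists>\<H>'. hereditary \<H>' \<and> vc_class \<H>' < \<infinity> \<and> close_to diag_class \<H>'"
  then obtain \<H>' where her: "hereditary \<H>'" and fin: "vc_class \<H>' < \<infinity>"
    and close: "close_to diag_class \<H>'" by blast
  obtain d where d: "vc_class \<H>' = enat d" using fin by (cases "vc_class \<H>'") auto
  define k where "k = Suc d"
  have ns: "\<not> hg_shatters G k" if "G \<in> \<H>'" for G
  proof
    assume "hg_shatters G k"
    then have "enat k \<le> hg_vc G" unfolding hg_vc_def by (intro Sup_upper) blast
    also have "\<dots> \<le> vc_class \<H>'" unfolding vc_class_def by (rule SUP_upper[OF that])
    finally show False by (simp add: d k_def)
  qed
  \<comment> \<open>The disagreements number at least \<open>k * 4 ^ k * m ^ 3\<close> among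
    \<open>27 * k ^ 3 * 8 ^ k * m ^ 3\<close> ordered triples, a fraction of
    \<open>1 / (27 * k ^ 2 * 2 ^ k)\<close>. Replacing 27 by 28 goes below it.\<close>
  define \<delta> :: real where "\<delta> = 1 / (28 * real k ^ 2 * 2 ^ k)"
  have "0 < real k" by (simp add: k_def)
  then have "0 < \<delta>" by (simp add: \<delta>_def)
  then obtain N where N: "\<And>G. G \<in> diag_class \<Longrightarrow> card (fst G) \<ge> N \<Longrightarrow>
      \<exists>G'\<in>\<H>'. fst G' = fst G \<and> delta_close \<delta> G G'"
    using close unfolding close_to_def by blast
  define m where "m = Suc N"
  have card_fst: "card (fst (blowup k m)) = 3 * (k * 2 ^ k * m)"
    by (simp add: blowup_def card_blow)
  have "N \<le> 1 * m" by (simp add: m_def)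
  also have "\<dots> \<le> (3 * (k * 2 ^ k)) * m" by (intro mult_right_mono) (simp_all add: k_def Suc_le_eq)
  finally have "N \<le> card (fst (blowup k m))" by (simp add: card_fst mult_ac)
  with N[OF blowup_in_class] obtain G' where G': "G' \<in> \<H>'" "fst G' = fst (blowup k m)"
    and dc: "delta_close \<delta> (blowup k m) G'" by blast
  have "is_3graph G'" using her G'(1) unfolding hereditary_def by blast
  from blowup_far_from_non_shattering[OF this G'(2) ns[OF G'(1)]] dc
  have "real (2 ^ k * m * (2 ^ k * m * (k * m))) \<le> \<delta> * real (3 * (k * 2 ^ k * m)) ^ 3"
    unfolding delta_close_def card_fst by linarith
  also have "\<dots> = 27 / 28 * real (2 ^ k * m * (2 ^ k * m * (k * m)))"
    using \<open>0 < real k\<close> by (simp add: \<delta>_def field_simps power2_eq_square power3_eq_cube)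
  finally have "real (2 ^ k * m * (2 ^ k * m * (k * m))) \<le> 0" by linarith
  moreover have "0 < 2 ^ k * m * (2 ^ k * m * (k * m))"
    unfolding nat_0_less_mult_iff by (simp add: k_def m_def)
  ultimately show False by linarith
qed

section \<open>Asymptotic bounds on the number of parts\<close>

definition reg_bounded :: "hg3 set \<Rightarrow> real \<Rightarrow> nat \<Rightarrow> bool" where
  "reg_bounded \<H> \<epsilon> M \<longleftrightarrow> (\<exists>N. \<forall>G\<in>\<H>. card (fst G) \<ge> N \<longrightarrow>
      (\<exists>P. regular_partition \<epsilon> G P \<and> card P \<le> M))"

lemma reg_bound_eq: "reg_bound \<H> \<epsilon> = (LEAST M. reg_bounded \<H> \<epsilon> M)"
  unfolding reg_bound_def reg_bounded_def ..

lemma reg_bounded_diag_class: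
  assumes "0 < \<epsilon>" "\<epsilon> \<le> 1"
  shows "reg_bounded diag_class \<epsilon> (nat \<lfloor>3 * 2 powr (6 / \<epsilon> ^ 5) :: real\<rfloor>)"
  unfolding reg_bounded_def
proof (rule exI, intro ballI impI)
  fix G assume "G \<in> diag_class"
  then obtain A B C f h where "G = diag_graph A B C f h" "tripartite A B C"
    by (auto simp: diag_class_def)
  then obtain P where "regular_partition \<epsilon> G P" "real (card P) \<le> 3 * 2 powr (6 / \<epsilon> ^ 5)"
    using tripartite.ex_small_regular_partition assms by blast
  then show "\<exists>P. regular_partition \<epsilon> G P \<and> card P \<le> nat \<lfloor>3 * 2 powr (6 / \<epsilon> ^ 5) :: real\<rfloor>"
    by (auto intro!: exI[of _ P] simp: le_nat_floor)
qed

lemma reg_bound_diag_class_le: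
  assumes "0 < \<epsilon>" "\<epsilon> \<le> 1"
  shows "real (reg_bound diag_class \<epsilon>) \<le> 3 * 2 powr (6 / \<epsilon> ^ 5)"
proof -
  have "reg_bound diag_class \<epsilon> \<le> nat \<lfloor>3 * 2 powr (6 / \<epsilon> ^ 5) :: real\<rfloor>"
    unfolding reg_bound_eq by (rule Least_le[of "reg_bounded diag_class \<epsilon>", OF reg_bounded_diag_class[OF assms]])
  also have "real (nat \<lfloor>3 * 2 powr (6 / \<epsilon> ^ 5) :: real\<rfloor>) \<le> 3 * 2 powr (6 / \<epsilon> ^ 5)"
    by (rule of_nat_floor) simp
  finally show ?thesis by simp
qed

text \<open>The upper bound shows that some number of parts is admissible, so the
  \<open>LEAST\<close> is itself admissible and can be applied to a large blowup.\<close>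

lemma exp_le_reg_bound_diag_class:
  assumes "0 < \<epsilon>" "\<epsilon> \<le> 1" "1 \<le> k" "228 * real k ^ 3 * \<epsilon> \<le> 1"
  shows "2 ^ k \<le> 2 * reg_bound diag_class \<epsilon>"
proof -
  have "reg_bounded diag_class \<epsilon> (reg_bound diag_class \<epsilon>)"
    unfolding reg_bound_eq by (rule LeastI[of "reg_bounded diag_class \<epsilon>", OF reg_bounded_diag_class[OF assms(1,2)]])
  then obtain N where N: "\<And>G. G \<in> diag_class \<Longrightarrow> N \<le> card (fst G) \<Longrightarrow>
      \<exists>P. regular_partition \<epsilon> G P \<and> card P \<le> reg_bound diag_class \<epsilon>"
    unfolding reg_bounded_def by blast
  have "N \<le> 1 * Suc N" by simp
  also have "\<dots> \<le> (3 * (k * 2 ^ k)) * Suc N" using assms(3) by (intro mult_right_mono) (simp_all add: Suc_le_eq)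
  also have "\<dots> = card (fst (blowup k (Suc N)))"
    by (simp only: blowup_def fst_diag_graph card_blow mult_ac)
  finally obtain P where P: "regular_partition \<epsilon> (blowup k (Suc N)) P"
    "card P \<le> reg_bound diag_class \<epsilon>"
    using N[OF blowup_in_class] by blast
  then show ?thesis
    using blowup_regular_partition_large[OF assms(3) _ assms(1,4) P(1)] by simp
qed

lemma reg_bound_diag_class_lower:
  "eventually (\<lambda>\<epsilon>. 2 powr (\<epsilon> powr (- (1 / 4))) \<le> real (reg_bound diag_class \<epsilon>)) (at_right 0)"
proof -
  \<comment> \<open>The gap between the exponents 1/3 and 1/4 absorbs the constants. Of the
    subtracted 2, one unit pays for rounding \<open>k\<close> down and one for the factor 2 in
    \<open>2 * reg_bound diag_class \<epsilon>\<close>.\<close>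
  have "eventually (\<lambda>\<epsilon>::real. \<epsilon> powr (- (1 / 4)) \<le> \<epsilon> powr (- (1 / 3)) / 7 - 2) (at_right 0)"
    by real_asymp
  moreover have "eventually (\<lambda>\<epsilon>::real. 1 \<le> \<epsilon> powr (- (1 / 3)) / 7) (at_right 0)"
    by real_asymp
  moreover have "eventually (\<lambda>\<epsilon>::real. 0 < \<epsilon> \<and> \<epsilon> \<le> 1) (at_right 0)"
    unfolding eventually_at_right_field by (intro exI[of _ 1]) auto
  ultimately show ?thesis
  proof eventually_elim
    case (elim \<epsilon>)
    \<comment> \<open>Since 7 ^ 3 = 343 exceeds 228, every \<open>k\<close> up to \<open>?x\<close>
      satisfies \<open>228 * real k ^ 3 * \<epsilon> \<le> 1\<close>.\<close>
    let ?x = "\<epsilon> powr (- (1 / 3)) / 7"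
    define k where "k = nat \<lfloor>?x\<rfloor>"
    have k1: "1 \<le> k" unfolding k_def using elim(2) by (simp add: le_nat_floor)
    have kx: "real k \<le> ?x" unfolding k_def using elim by (intro of_nat_floor) simp
    have kx': "?x - 1 \<le> real k" unfolding k_def by linarith
    have "real k ^ 3 \<le> ?x ^ 3" using kx by (intro power_mono) auto
    also have "?x ^ 3 = (\<epsilon> powr (- (1 / 3))) ^ 3 / 343" by (simp add: power_divide)
    also have "(\<epsilon> powr (- (1 / 3))) ^ 3 = inverse \<epsilon>"
    proof -
      have "(\<epsilon> powr (- (1 / 3))) ^ 3 = \<epsilon> powr (- 1)"
        using elim by (subst powr_power) auto
      then show ?thesis using elim by (simp add: powr_minus)
    qed
    finally have "228 * real k ^ 3 * \<epsilon> \<le> 228 * (inverse \<epsilon> / 343) * \<epsilon>"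
      using elim by (intro mult_right_mono mult_left_mono) auto
    also have "\<dots> = 228 / 343" using elim by (simp add: field_simps)
    also have "\<dots> \<le> 1" by simp
    finally have "2 ^ k \<le> 2 * reg_bound diag_class \<epsilon>"
      using elim k1 by (intro exp_le_reg_bound_diag_class) auto
    then have "real (2 ^ k) \<le> real (2 * reg_bound diag_class \<epsilon>)" by (simp only: of_nat_le_iff)
    then have "2 powr (real k - 1) \<le> real (reg_bound diag_class \<epsilon>)"
      by (simp add: powr_diff powr_realpow)
    moreover have "2 powr (\<epsilon> powr (- (1 / 4))) \<le> 2 powr (real k - 1)"
      using elim(1) kx' by (intro powr_mono) auto
    ultimately show ?case by linarith
  qed
qed

lemma reg_bound_diag_class_upper:
  "eventually (\<lambda>\<epsilon>. real (reg_bound diag_class \<epsilon>) \<le> 2 powr (\<epsilon> powr (- 6))) (at_right 0)"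
proof -
  \<comment> \<open>The summand 2 covers the factor 3, at most \<open>2 ^ 2\<close>; raising the
    exponent from 5 to 6 absorbs the coefficient.\<close>
  have "eventually (\<lambda>\<epsilon>::real. 2 + 6 / \<epsilon> ^ 5 \<le> \<epsilon> powr (- 6)) (at_right 0)"
    by real_asymp
  moreover have "eventually (\<lambda>\<epsilon>::real. 0 < \<epsilon> \<and> \<epsilon> \<le> 1) (at_right 0)"
    unfolding eventually_at_right_field by (intro exI[of _ 1]) auto
  ultimately show ?thesis
  proof eventually_elim
    case (elim \<epsilon>)
    have "real (reg_bound diag_class \<epsilon>) \<le> 3 * 2 powr (6 / \<epsilon> ^ 5)"
      using elim by (intro reg_bound_diag_class_le) auto
    also have "\<dots> \<le> 4 * 2 powr (6 / \<epsilon> ^ 5)" by simp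
    also have "\<dots> = 2 powr (2 + 6 / \<epsilon> ^ 5)" by (simp add: powr_add)
    also have "\<dots> \<le> 2 powr (\<epsilon> powr (- 6))" using elim(1) by (intro powr_mono) auto
    finally show ?case .
  qed
qed

theorem theorem6p8:
  shows "\<exists>\<H> :: hg3 set. hereditary \<H> \<and> svc_class \<H> < \<infinity> \<and> far_from_finite_vc \<H> \<and>
    (\<exists>C C' :: real. C > 0 \<and> C' > 0 \<and>
      (\<exists>\<epsilon>0 > 0. \<forall>\<epsilon>::real. 0 < \<epsilon> \<and> \<epsilon> < \<epsilon>0 \<longrightarrow>
         2 powr (\<epsilon> powr (- C)) \<le> real (reg_bound \<H> \<epsilon>) \<and>
         real (reg_bound \<H> \<epsilon>) \<le> 2 powr (\<epsilon> powr (- C'))))"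
proof (rule exI[of _ diag_class], intro conjI)
  show "hereditary diag_class" by (rule hereditary_diag_class)
  show "svc_class diag_class < \<infinity>"
    using svc_diag_class by (metis enat_ord_code(4) one_enat_def order_le_less_trans)
  show "far_from_finite_vc diag_class" by (rule far_diag_class)
  have "\<exists>\<epsilon>0 > 0. \<forall>\<epsilon>::real. 0 < \<epsilon> \<and> \<epsilon> < \<epsilon>0 \<longrightarrow>
      2 powr (\<epsilon> powr (- (1 / 4))) \<le> real (reg_bound diag_class \<epsilon>) \<and>
      real (reg_bound diag_class \<epsilon>) \<le> 2 powr (\<epsilon> powr (- 6))"
    using eventually_conj[OF reg_bound_diag_class_lower reg_bound_diag_class_upper]
    unfolding eventually_at_right_field by (simp only: imp_conjL)
  then show "\<exists>C C' :: real. C > 0 \<and> C' > 0 \<and>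
      (\<exists>\<epsilon>0 > 0. \<forall>\<epsilon>::real. 0 < \<epsilon> \<and> \<epsilon> < \<epsilon>0 \<longrightarrow>
         2 powr (\<epsilon> powr (- C)) \<le> real (reg_bound diag_class \<epsilon>) \<and>
         real (reg_bound diag_class \<epsilon>) \<le> 2 powr (\<epsilon> powr (- C')))"
    by - (rule exI[of _ "1 / 4"], rule exI[of _ 6], simp)
qed

end
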